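(* Let $(a,b)\in\mathcal P$, $a\ne0$, $b\ne0$, and assume that the map $f_{a,b}$ satisfies the finiteness condition. Then there exists a set $A_{a,b}\subsetneq\bar{\mathbb R}^2$ with the following properties: (A1) The set $A_{a,b}$ consists of two connected components, each having finite rectangular structure, i.e. bounded by non-decreasing step-functions with a finite number of steps. (A2) $F_{a,b}:A_{a,b}\to A_{a,b}$ is a bijection except for some images of the boundary of $A_{a,b}$.
   Context: $T(x)=x+1$ and $S(x)=-1/x$, acting on $\bar{\mathbb R}=\mathbb R\cup\{\infty\}$ and generating the modular group $SL(2,\mathbb Z)$ (acting by fractional linear transformations). $\mathcal P=\{(a,b)\in\mathbb R^2 : a\le 0\le b,\ b-a\ge 1,\ -ab\le 1\}$. The map $f=f_{a,b}:\bar{\mathbb R}\to\bar{\mathbb R}$ is $f(x)=x+1$ if $x<a$, $f(x)=-1/x$ if $a\le x<b$, $f(x)=x-1$ if $x\ge b$. With $\Delta=\{(x,y)\in\bar{\mathbb R}^2:x=y\}$, the map $F_{a,b}:\bar{\mathbb R}^2\setminus\Delta\to\bar{\mathbb R}^2\setminus\Delta$ is $F_{a,b}(x,y)=(x+1,y+1)$ if $y<a$, $(-1/x,-1/y)$ if $a\le y<b$, $(x-1,y-1)$ if $y\ge b$. Orbits: the upper orbit of $a$ is $\{f^n(Sa)\}_{n\ge0}$, the lower orbit of $a$ is $\{f^n(Ta)\}_{n\ge0}$, the lower orbit of $b$ is $\{f^n(Sb)\}_{n\ge0}$ and the upper orbit of $b$ is $\{f^n(T^{-1}b)\}_{n\ge0}$.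 Convention: a lower orbit hitting $a$ (resp. $b$) continues with $Ta$ (resp. $Sb$); an upper orbit hitting $a$ (resp. $b$) continues with $Sa$ (resp. $T^{-1}b$). Cycles: $a$ has the cycle property if $f^{m_1}(Sa)=f^{k_1}(Ta)$ for some non-negative integers $m_1,k_1$ (the cycle being taken up to the first common value); its upper part is $\{Sa,\dots,f^{m_1-1}Sa\}$ and its lower part is $\{Ta,\dots,f^{k_1-1}Ta\}$; the cycle property is strong if $T^{-1}f^{-k_1}f^{m_1}S=\mathrm{Id}$ (powers of $f$ denoting the products of $T,S,T^{-1}$ applied along the orbit), and weak otherwise. Likewise $b$ has the cycle property if $f^{k_2}(Sb)=f^{m_2}(T^{-1}b)$, with lower part $\{Sb,\dots,f^{k_2-1}Sb\}$ and upper part $\{T^{-1}b,\dots,f^{m_2-1}T^{-1}b\}$, strong if $Tf^{-m_2}f^{k_2}S=\mathrm{Id}$, weak otherwise. Truncated orbits: for $c\in\{a,b\}$, $\mathcal L_c$ (resp. $\mathcal U_c$) is the whole lower (resp. upper) orbit of $c$ if $c$ has no cycle property; the lower (resp. upper) part of the $c$-cycle if $c$ has the strong cycle property; and the lower (resp. upper) part of the $c$-cycle together with $0$ if $c$ has the weak cycle property. The map $f_{a,b}$ satisfies the finiteness condition if the sets of values in all four truncated orbits $\mathcal L_a,\mathcal L_b,\mathcal U_a,\mathcal U_b$ are finite. *)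

theory Defs
  imports "HOL-Analysis.Analysis"
begin

section \<open>The extended real line and the generators of the modular group\<close>

text \<open>
  The extended line has a single point at infinity: it is the one-point compactification of the
  reals (a circle), with \<^term>\<open>None\<close> in the role of infinity. This is not the type \<open>ereal\<close>, which
  has two infinite points.
\<close>

type_synonym rbar = "real option"

definition rbar_plane :: "(rbar \<times> rbar) topology" where
  "rbar_plane = prod_topology (Alexandroff_compactification euclideanreal)
                              (Alexandroff_compactification euclideanreal)"

definition mT :: "rbar \<Rightarrow> rbar" where
  "mT = map_option (\<lambda>t. t + 1)"

definition mTinv :: "rbar \<Rightarrow> rbar" where
  "mTinv = map_option (\<lambda>t. t - 1)"

definition mS :: "rbar \<Rightarrow> rbar" where
  "mS x = (case x of None \<Rightarrow> Some 0 | Some t \<Rightarrow> if t = 0 then None else Some (- (1 / t)))"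

definition parameter_set :: "(real \<times> real) set" where
  "parameter_set = {(a, b). a \<le> 0 \<and> 0 \<le> b \<and> b - a \<ge> 1 \<and> - (a * b) \<le> 1}"


section \<open>The maps on the line and on the plane\<close>

text \<open>
  The generator that is applied at \<open>y\<close>. Infinity is counted among the points \<open>\<ge> b\<close>. For the line map
  this is immaterial, since both translations fix infinity.
\<close>

definition branch :: "real \<Rightarrow> real \<Rightarrow> rbar \<Rightarrow> (rbar \<Rightarrow> rbar)" where
  "branch a b y = (case y of
       None \<Rightarrow> mTinv
     | Some t \<Rightarrow> if t < a then mT else if t < b then mS else mTinv)"

definition f_ab :: "real \<Rightarrow> real \<Rightarrow> rbar \<Rightarrow> rbar" where
  "f_ab a b x = branch a b x x"

definition diagonal :: "(rbar \<times> rbar) set" where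
  "diagonal = {(x, y). x = y}"

text \<open>The plane map is only meaningful off the diagonal, whose complement it preserves.\<close>

definition F_ab :: "real \<Rightarrow> real \<Rightarrow> rbar \<times> rbar \<Rightarrow> rbar \<times> rbar" where
  "F_ab a b = (\<lambda>(x, y). (branch a b y x, branch a b y y))"


section \<open>Upper and lower orbits\<close>

text \<open>
  Conventions at the discontinuities: an upper orbit continues with \<open>S a\<close> at \<open>a\<close> and with
  \<open>T\<^sup>-\<^sup>1 b\<close> at \<open>b\<close>, which is what \<^const>\<open>branch\<close> does; a lower orbit continues with \<open>T a\<close> at \<open>a\<close> and
  with \<open>S b\<close> at \<open>b\<close>, which is the variant below.
\<close>

definition lower_branch :: "real \<Rightarrow> real \<Rightarrow> rbar \<Rightarrow> (rbar \<Rightarrow> rbar)" where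
  "lower_branch a b y = (case y of
       None \<Rightarrow> mTinv
     | Some t \<Rightarrow> if t \<le> a then mT else if t \<le> b then mS else mTinv)"

text \<open>With \<open>br = branch a b\<close> the map iterated here is \<^term>\<open>f_ab a b\<close>.\<close>

definition orbit_pt :: "(rbar \<Rightarrow> rbar \<Rightarrow> rbar) \<Rightarrow> rbar \<Rightarrow> nat \<Rightarrow> rbar" where
  "orbit_pt br x n = ((\<lambda>z. br z z) ^^ n) x"

text \<open>
  The product of the first \<open>n\<close> generators applied along the orbit of \<open>x\<close>, as a transformation of the
  extended line. It sends \<open>x\<close> to \<^term>\<open>orbit_pt br x n\<close>.
\<close>

primrec orbit_word :: "(rbar \<Rightarrow> rbar \<Rightarrow> rbar) \<Rightarrow> rbar \<Rightarrow> nat \<Rightarrow> (rbar \<Rightarrow> rbar)" where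
  "orbit_word br x 0 = id"
| "orbit_word br x (Suc n) = br (orbit_pt br x n) \<circ> orbit_word br x n"

definition upper_a :: "real \<Rightarrow> real \<Rightarrow> nat \<Rightarrow> rbar" where
  "upper_a a b = orbit_pt (branch a b) (mS (Some a))"

definition lower_a :: "real \<Rightarrow> real \<Rightarrow> nat \<Rightarrow> rbar" where
  "lower_a a b = orbit_pt (lower_branch a b) (mT (Some a))"

definition upper_b :: "real \<Rightarrow> real \<Rightarrow> nat \<Rightarrow> rbar" where
  "upper_b a b = orbit_pt (branch a b) (mTinv (Some b))"

definition lower_b :: "real \<Rightarrow> real \<Rightarrow> nat \<Rightarrow> rbar" where
  "lower_b a b = orbit_pt (lower_branch a b) (mS (Some b))"


section \<open>The cycle property\<close>

definition has_cycle :: "(nat \<Rightarrow> rbar) \<Rightarrow> (nat \<Rightarrow> rbar) \<Rightarrow> bool" where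
  "has_cycle u l \<longleftrightarrow> (\<exists>m k. u m = l k)"

text \<open>
  A cycle ends at the first common value, read as the first point of the upper orbit that lies on the
  lower orbit, with the first index at which each orbit takes this value. Reading ``first'' along the
  lower orbit could only differ when both orbits run into one periodic orbit at different points; the
  truncated orbits are finite under either reading, so the finiteness condition is unaffected.
\<close>

definition upper_len :: "(nat \<Rightarrow> rbar) \<Rightarrow> (nat \<Rightarrow> rbar) \<Rightarrow> nat" where
  "upper_len u l = (LEAST m. \<exists>k. u m = l k)"

definition lower_len :: "(nat \<Rightarrow> rbar) \<Rightarrow> (nat \<Rightarrow> rbar) \<Rightarrow> nat" where
  "lower_len u l = (LEAST k. u (upper_len u l) = l k)"

text \<open>
  The identities \<open>T\<^sup>-\<^sup>1 f\<^sup>-\<^sup>k f\<^sup>m S = Id\<close> for \<open>a\<close> and \<open>T f\<^sup>-\<^sup>m f\<^sup>k S = Id\<close> for \<open>b\<close> are between fractional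
  linear transformations, i.e. between maps of the extended line.
\<close>

definition strong_cycle_a :: "real \<Rightarrow> real \<Rightarrow> bool" where
  "strong_cycle_a a b \<longleftrightarrow>
     has_cycle (upper_a a b) (lower_a a b) \<and>
     (let m = upper_len (upper_a a b) (lower_a a b);
          k = lower_len (upper_a a b) (lower_a a b)
      in mTinv \<circ> inv (orbit_word (lower_branch a b) (mT (Some a)) k)
           \<circ> orbit_word (branch a b) (mS (Some a)) m \<circ> mS = id)"

definition strong_cycle_b :: "real \<Rightarrow> real \<Rightarrow> bool" where
  "strong_cycle_b a b \<longleftrightarrow>
     has_cycle (upper_b a b) (lower_b a b) \<and>
     (let m = upper_len (upper_b a b) (lower_b a b);
          k = lower_len (upper_b a b) (lower_b a b)
      in mT \<circ> inv (orbit_word (branch a b) (mTinv (Some b)) m)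
           \<circ> orbit_word (lower_branch a b) (mS (Some b)) k \<circ> mS = id)"


section \<open>Truncated orbits and the finiteness condition\<close>

definition truncated_orbit :: "bool \<Rightarrow> bool \<Rightarrow> (nat \<Rightarrow> rbar) \<Rightarrow> nat \<Rightarrow> rbar set" where
  "truncated_orbit cyc strong orb n =
     (if \<not> cyc then range orb
      else if strong then orb ` {..<n}
      else orb ` {..<n} \<union> {Some 0})"

definition trunc_L_a :: "real \<Rightarrow> real \<Rightarrow> rbar set" where
  "trunc_L_a a b = truncated_orbit (has_cycle (upper_a a b) (lower_a a b)) (strong_cycle_a a b)
                     (lower_a a b) (lower_len (upper_a a b) (lower_a a b))"

definition trunc_U_a :: "real \<Rightarrow> real \<Rightarrow> rbar set" where
  "trunc_U_a a b = truncated_orbit (has_cycle (upper_a a b) (lower_a a b)) (strong_cycle_a a b)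
                     (upper_a a b) (upper_len (upper_a a b) (lower_a a b))"

definition trunc_L_b :: "real \<Rightarrow> real \<Rightarrow> rbar set" where
  "trunc_L_b a b = truncated_orbit (has_cycle (upper_b a b) (lower_b a b)) (strong_cycle_b a b)
                     (lower_b a b) (lower_len (upper_b a b) (lower_b a b))"

definition trunc_U_b :: "real \<Rightarrow> real \<Rightarrow> rbar set" where
  "trunc_U_b a b = truncated_orbit (has_cycle (upper_b a b) (lower_b a b)) (strong_cycle_b a b)
                     (upper_b a b) (upper_len (upper_b a b) (lower_b a b))"

definition finiteness_condition :: "real \<Rightarrow> real \<Rightarrow> bool" where
  "finiteness_condition a b \<longleftrightarrow>
     finite (trunc_L_a a b) \<and> finite (trunc_L_b a b) \<and>
     finite (trunc_U_a a b) \<and> finite (trunc_U_b a b)"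


section \<open>Finite rectangular structure\<close>

text \<open>
  A monotone function with finite range is a step function with finitely many steps. The values
  \<open>\<infinity>\<close> and \<open>-\<infinity>\<close> are allowed because the regions lie over half-lines: where a region
  \<open>{(x, y). h x \<le> y}\<close> has no points over \<open>x\<close>, \<open>h x = \<infinity>\<close>.
\<close>

definition step_function :: "(real \<Rightarrow> ereal) \<Rightarrow> bool" where
  "step_function h \<longleftrightarrow> mono h \<and> finite (range h)"

text \<open>
  The region above (or below) the graph of a non-decreasing step function. Points of the bounding
  graph itself may or may not belong to the region.
\<close>

definition finite_rectangular :: "(real \<times> real) set \<Rightarrow> bool" where
  "finite_rectangular C \<longleftrightarrow> (\<exists>h. step_function h \<and>
     ({(x, y). h x < ereal y} \<subseteq> C \<and> C \<subseteq> {(x, y). h x \<le> ereal y} \<or>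
      {(x, y). ereal y < h x} \<subseteq> C \<and> C \<subseteq> {(x, y). ereal y \<le> h x}))"

definition finite_part :: "(rbar \<times> rbar) set \<Rightarrow> (real \<times> real) set" where
  "finite_part A = {(x, y). (Some x, Some y) \<in> A}"

text \<open>
  The two components are those of the picture in the real plane. On the torus \<^const>\<open>rbar_plane\<close> the
  upper region (unbounded to the left and upwards) and the lower region (unbounded to the right and
  downwards) may touch along the lines at infinity. Points at infinity have to be limits of finite
  points of the set.
\<close>

definition two_rectangular_components :: "(rbar \<times> rbar) set \<Rightarrow> bool" where
  "two_rectangular_components A \<longleftrightarrow>
     card (components (finite_part A)) = 2 \<and>
     (\<forall>C \<in> components (finite_part A). finite_rectangular C) \<and>
     A \<subseteq> rbar_plane closure_of ((\<lambda>(x, y). (Some x, Some y)) ` finite_part A)"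

text \<open>
  \<open>G\<close> maps \<open>A\<close> into itself, and every point of \<open>A\<close> has exactly one preimage in \<open>A\<close>, except possibly
  for points that are images of boundary points of \<open>A\<close>.
\<close>

definition bijection_except_boundary ::
    "(rbar \<times> rbar \<Rightarrow> rbar \<times> rbar) \<Rightarrow> (rbar \<times> rbar) set \<Rightarrow> bool" where
  "bijection_except_boundary G A \<longleftrightarrow>
     G ` A \<subseteq> A \<and>
     (\<forall>q \<in> A - G ` (rbar_plane frontier_of A). \<exists>!p. p \<in> A \<and> G p = q)"

end

theory Submission
  imports Defs
begin

text \<open>
  Write \<open>S x = -1/x\<close>. The slice of \<open>A\<close> over a real level \<open>y\<close> consists of the \<open>x \<ge> low y\<close> (if
  \<open>y < a + 1\<close>) and of the \<open>x \<le> up y\<close> (if \<open>y \<ge> b - 1\<close>), where \<open>low\<close> and \<open>up\<close> are non-decreasing step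
  functions with \<open>up y < y < low y\<close>: up to the point \<open>\<infinity>\<close>, it is an arc of the circle through \<open>\<infinity>\<close>
  that misses \<open>y\<close>. The map \<open>F\<close> permutes the points of \<open>A\<close> up to end points of arcs if, for every
  level, the images of the arcs over the preimages of that level tile the arc over it. For
  \<open>S b \<le> y < a + 1\<close> the only preimage that contributes to the lower region over \<open>y\<close> is \<open>y - 1\<close>, so that
  \<open>low y = low (y - 1) + 1\<close>. For \<open>y < S b\<close> there are two preimages, \<open>y - 1\<close> and \<open>S y\<close>, whose arcs are
  mapped to the right and to the left part of the arc over \<open>y\<close>. Hence \<open>low y = S (low (S y))\<close>, and
  the two parts must fit: \<open>low (y - 1) + 1 = S (up (S y))\<close>; here \<open>low\<close> is read as \<open>\<infinity>\<close> on levels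
  \<open>\<ge> a + 1\<close>, and \<open>up\<close> on levels \<open>< b - 1\<close>.
  The conditions on the upper region are the mirror images.

  The fitting conditions look like an overdetermined system, but they all reduce to the single
  relation \<open>up (S p) = S (low p)\<close> for \<open>p\<close> in \<open>[S b, a)\<close>: following both boundaries backwards from
  a place where two parts must fit leads to this relation or to a place where both values are known,
  and following the relation itself backwards leads to the same relation at another point or to
  known values. So take as the only unknown the function \<open>\<phi>\<close>, the restriction of \<open>low\<close> to
  \<open>[S b, a)\<close>. The system becomes the Farey recursion

    \<open>\<phi> p = \<phi> (p - 1) + 1\<close>, if \<open>p - 1 \<ge> S b\<close>,

    \<open>1 / \<phi> p = 1 / \<phi> (p / (1 - p)) + 1\<close>, if \<open>p / (1 - p) < a\<close>,

    \<open>\<phi> p = 1\<close> otherwise.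

  The first two cases exclude each other because \<open>b - a \<ge> 1\<close>. A solution is the limit of an
  increasing iteration (\<open>phi_fixed\<close>), and it is non-decreasing. It is constant
  between the points at which the case changes, \<open>1 - 1/b\<close> and \<open>a / (1 + a)\<close>, and their iterates under the
  inverse of the recursion. These iterates \<open>z\<close> lie on the lower orbit of \<open>b\<close> or of \<open>a\<close>, and the points
  \<open>S z\<close> lie on the upper orbit. If there were infinitely many of them, the lower orbit would be
  infinite and would stay in \<open>(-\<infinity>, a) \<union> (0, b]\<close>, whereas the upper orbit would stay in
  \<open>[a, 0) \<union> (b, \<infinity>)\<close>; then there is no cycle and the finiteness condition fails
  (\<open>finite_jump_orbit_a\<close>, \<open>finite_jump_orbit_b\<close>). Therefore \<open>\<phi>\<close> has finite range
  (\<open>finite_phi\<close>), and so have \<open>low\<close> and \<open>up\<close>.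

  The reflection \<open>y \<mapsto> -y\<close> exchanges \<open>a\<close> with \<open>-b\<close>, the lower region with the upper region, and
  \<open>\<phi> p\<close> with \<open>1 / \<phi> (1 / p)\<close>. It turns the half-open interval \<open>[a, b)\<close> into \<open>(-b, -a]\<close>; therefore
  the lower region is studied for both conventions at the end points at once, and every statement
  about the upper region is obtained by reflection.

  Bijectivity off the boundary is then a matter of arcs (\<open>low_matches_up\<close>, \<open>F_surjective\<close>,
  \<open>F_injective\<close>): if a point has two preimages, one of them is an end point of its arc and hence a boundary point
  of \<open>A\<close>. The points of \<open>A\<close> have finite first coordinate; a point \<open>(0, y)\<close> without a
  preimage in \<open>A\<close> is the image of the boundary point \<open>(\<infinity>, S y)\<close>.
\<close>

section \<open>Points and branches\<close>

lemma branch_simps: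
  "t < a \<Longrightarrow> branch a b (Some t) (Some t) = Some (t + 1)"
  "a \<le> t \<Longrightarrow> t < b \<Longrightarrow> t \<noteq> 0 \<Longrightarrow> branch a b (Some t) (Some t) = Some (- 1 / t)"
  "a < b \<Longrightarrow> b \<le> t \<Longrightarrow> branch a b (Some t) (Some t) = Some (t - 1)"
  by (auto simp: branch_def mT_def mTinv_def mS_def)

lemma lower_branch_simps:
  "t \<le> a \<Longrightarrow> lower_branch a b (Some t) (Some t) = Some (t + 1)"
  "a < t \<Longrightarrow> t \<le> b \<Longrightarrow> t \<noteq> 0 \<Longrightarrow> lower_branch a b (Some t) (Some t) = Some (- 1 / t)"
  by (auto simp: lower_branch_def mT_def mTinv_def mS_def)

lemma orbit_pt_0: "orbit_pt br x 0 = x"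
  and orbit_pt_Suc: "orbit_pt br x (Suc n) = br (orbit_pt br x n) (orbit_pt br x n)"
  by (auto simp: orbit_pt_def)

lemma orbit_pt_closed:
  assumes "x \<in> P" "\<And>y. y \<in> P \<Longrightarrow> br y y \<in> P"
  shows "orbit_pt br x n \<in> P"
  by (induction n) (auto simp: orbit_pt_0 orbit_pt_Suc assms)

lemma farey_ge: "p < 1 \<Longrightarrow> p \<le> p / (1 - (p::real))"
proof -
  assume y: "p < 1"
  have "p * (1 - p) \<le> p" by (simp add: algebra_simps)
  then show ?thesis using y by (simp add: pos_le_divide_eq)
qed

lemma farey_mono: "p \<le> q \<Longrightarrow> q < 1 \<Longrightarrow> p / (1 - p) \<le> q / (1 - (q::real))"
  by (simp add: field_simps)

text \<open>
  The parameters of the theorem. Since \<open>a\<close> and \<open>b\<close> are nonzero, they have strict signs.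
\<close>

locale parameters =
  fixes a b :: real
  assumes a_neg: "a < 0" and b_pos: "0 < b" and ab_diff: "1 \<le> b - a" and ab_prod: "- (a * b) \<le> 1"
begin

lemma Sb_le_a: "- 1 / b \<le> a"
  using ab_prod b_pos by (simp add: field_simps)

section \<open>Jumps of the boundary follow the orbits of a and b\<close>

text \<open>
  The recursion expresses a boundary value at \<open>p\<close> by the value at \<open>p - 1\<close> or at \<open>p / (1 - p)\<close>. A jump
  at \<open>z\<close> therefore creates a jump at \<open>z + 1\<close> or at \<open>z / (1 + z)\<close>, provided that \<open>z\<close> is interior to the
  range of the respective move: these ranges are described by the two predicates below. The end points
  of the ranges create no jumps, since the steps of the boundary are closed on the left, like the ranges.
\<close>

definition good_shift :: "real \<Rightarrow> bool" where
  "good_shift z \<longleftrightarrow> - 1 / b < z \<and> z < a - 1"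

definition good_farey :: "real \<Rightarrow> bool" where
  "good_farey z \<longleftrightarrow> - 1 / (b + 1) < z \<and> z < a"

definition next_jump :: "real \<Rightarrow> real" where
  "next_jump z = (if good_shift z then z + 1 else z / (1 + z))"

definition jump_orbit :: "real \<Rightarrow> real set" where
  "jump_orbit z0 = {(next_jump ^^ n) z0 | n. \<forall>i<n. good_shift ((next_jump ^^ i) z0) \<or> good_farey ((next_jump ^^ i) z0)}"

lemma jump_orbit_start: "z0 \<in> jump_orbit z0"
  unfolding jump_orbit_def by (rule CollectI, rule exI[of _ 0]) simp

lemma jump_orbit_next:
  assumes "z \<in> jump_orbit z0" "good_shift z \<or> good_farey z"
  shows "next_jump z \<in> jump_orbit z0"
proof -
  obtain n where n: "z = (next_jump ^^ n) z0"
    "\<forall>i<n. good_shift ((next_jump ^^ i) z0) \<or> good_farey ((next_jump ^^ i) z0)"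
    using assms(1) by (auto simp: jump_orbit_def)
  then have "next_jump z = (next_jump ^^ Suc n) z0"
    "\<forall>i<Suc n. good_shift ((next_jump ^^ i) z0) \<or> good_farey ((next_jump ^^ i) z0)"
    using assms(2) by (auto simp: less_Suc_eq)
  then show ?thesis unfolding jump_orbit_def by blast
qed

lemma good_farey_bounds:
  assumes "good_farey z"
  shows "- 1 < z" "- 1 / b < z" "z < 0" "0 < z + 1" "z + 1 < b" "a < z + 1" "- 1 / (z + 1) < a"
    "\<not> good_shift z"
proof -
  have "- 1 \<le> - 1 / (b + 1)" "- 1 / b \<le> - 1 / (b + 1)"
    using b_pos by (auto simp: field_simps)
  then show 1: "- 1 < z" "- 1 / b < z" and 2: "z < 0" "0 < z + 1" "z + 1 < b" "a < z + 1"
    using assms a_neg ab_diff by (auto simp: good_farey_def)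
  show "\<not> good_shift z" using 1 a_neg by (auto simp: good_shift_def)
  have "- 1 / (z + 1) < - 1 / b" using 2 by (simp add: field_simps)
  then show "- 1 / (z + 1) < a" using Sb_le_a by linarith
qed

text \<open>
  Let \<open>W\<close> be an endless forward orbit of jumps. The next two sets contain all points that the lower
  orbit, starting at \<open>z \<in> W\<close>, and the upper orbit, starting at \<open>S z\<close>, pass through. For
  the move \<open>z \<mapsto> z + 1\<close> the lower orbit makes one step and the upper orbit makes the
  detour \<open>S z, S z - 1, z / (z + 1), S (z + 1)\<close>; for the move \<open>z \<mapsto> z / (1 + z)\<close> the roles are exchanged.
\<close>

definition lower_points :: "real set \<Rightarrow> real set" where
  "lower_points W = W \<union> (\<lambda>z. z + 1) ` {z\<in>W. good_farey z} \<union> (\<lambda>z. - 1 / (z + 1)) ` {z\<in>W. good_farey z}"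

definition upper_points :: "real set \<Rightarrow> real set" where
  "upper_points W = (\<lambda>z. - 1 / z) ` W \<union> (\<lambda>z. - (z + 1) / z) ` {z\<in>W. good_shift z}
      \<union> (\<lambda>z. z / (z + 1)) ` {z\<in>W. good_shift z}"

context
  fixes W :: "real set"
  assumes good: "\<And>z. z \<in> W \<Longrightarrow> good_shift z \<or> good_farey z"
    and closed: "\<And>z. z \<in> W \<Longrightarrow> next_jump z \<in> W"
begin

lemma W_bounds: "z \<in> W \<Longrightarrow> - 1 / b < z" "z \<in> W \<Longrightarrow> z < a" "z \<in> W \<Longrightarrow> z < 0" "z \<in> W \<Longrightarrow> b < - 1 / z"
proof -
  assume z: "z \<in> W"
  then show 1: "- 1 / b < z" "z < a" "z < 0"
    using good[OF z] good_farey_bounds[of z] a_neg by (auto simp: good_shift_def good_farey_def)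
  then show "b < - 1 / z" using b_pos by (simp add: field_simps)
qed

lemma shift_bounds:
  assumes "z \<in> W" "good_shift z"
  shows "- (z + 1) / z < 0" "a \<le> - (z + 1) / z" "b \<le> z / (z + 1)" "z < - 1"
proof -
  have b: "b < - 1 / z" "z < 0" using W_bounds assms by auto
  have "z < a - 1" using assms by (simp add: good_shift_def)
  then show z: "z < - 1" using a_neg by linarith
  then have eq: "- (z + 1) / z = - 1 / z - 1" by (simp add: field_simps)
  show "a \<le> - (z + 1) / z" unfolding eq using b ab_diff by linarith
  show "- (z + 1) / z < 0" using z by (simp add: field_simps)
  have "- 1 / z < 1" using z by (simp add: field_simps)
  then have b1: "b < 1" using b by linarith
  have "1 < z / (z + 1)" using z by (simp add: field_simps)
  then show "b \<le> z / (z + 1)" using b1 by linarith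
qed

text \<open>
  The ranges in the next two lemmas are disjoint. So the lower and the upper orbit never meet when they
  follow an endless jump orbit.
\<close>

lemma lower_points_range: "y \<in> lower_points W \<Longrightarrow> y < a \<or> 0 < y \<and> y \<le> b"
  using W_bounds good_farey_bounds by (auto simp: lower_points_def less_imp_le)

lemma upper_points_range: "y \<in> upper_points W \<Longrightarrow> a \<le> y \<and> y < 0 \<or> b < y"
proof -
  have "b < z / (z + 1)" if "z \<in> W" "good_shift z" for z
  proof -
    have "1 < z / (z + 1)" "- 1 / z < 1"
      using shift_bounds(4)[OF that] by (auto simp: field_simps)
    then show ?thesis using W_bounds(4)[OF that(1)] by linarith
  qed
  moreover assume "y \<in> upper_points W"
  ultimately show ?thesis using W_bounds shift_bounds by (auto simp: upper_points_def)
qed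

lemma lower_points_closed:
  "y \<in> Some ` lower_points W \<Longrightarrow> lower_branch a b y y \<in> Some ` lower_points W"
proof -
  assume "y \<in> Some ` lower_points W"
  then obtain z where z: "z \<in> W"
    and "y = Some z \<or> good_farey z \<and> (y = Some (z + 1) \<or> y = Some (- 1 / (z + 1)))"
    by (auto simp: lower_points_def)
  then consider "y = Some z" | "good_farey z" "y = Some (z + 1)" | "good_farey z" "y = Some (- 1 / (z + 1))"
    by blast
  then show ?thesis
  proof cases
    case 1
    have "lower_branch a b y y = Some (z + 1)"
      using 1 W_bounds[OF z] by (simp add: lower_branch_simps)
    moreover have "z + 1 \<in> lower_points W"
      using good[OF z] closed[OF z] z by (auto simp: lower_points_def next_jump_def)
    ultimately show ?thesis by simp
  next
    case 2
    then have "lower_branch a b y y = Some (- 1 / (z + 1))"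
      using good_farey_bounds[OF 2(1)] by (simp add: lower_branch_simps)
    then show ?thesis using z 2 by (auto simp: lower_points_def)
  next
    case 3
    then have "lower_branch a b y y = Some (- 1 / (z + 1) + 1)"
      using good_farey_bounds[OF 3(1)] by (simp add: lower_branch_simps)
    also have "- 1 / (z + 1) + 1 = next_jump z"
      using good_farey_bounds[OF 3(1)] by (simp add: next_jump_def field_simps)
    finally show ?thesis using closed[OF z] by (auto simp: lower_points_def)
  qed
qed

lemma upper_points_closed:
  "y \<in> Some ` upper_points W \<Longrightarrow> branch a b y y \<in> Some ` upper_points W"
proof -
  have ab: "a < b" using a_neg b_pos by linarith
  assume "y \<in> Some ` upper_points W"
  then obtain z where z: "z \<in> W"
    and "y = Some (- 1 / z) \<or> good_shift z \<and> (y = Some (- (z + 1) / z) \<or> y = Some (z / (z + 1)))"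
    by (auto simp: upper_points_def)
  then consider "y = Some (- 1 / z)" | "good_shift z" "y = Some (- (z + 1) / z)" | "good_shift z" "y = Some (z / (z + 1))"
    by blast
  then show ?thesis
  proof cases
    case 1
    have "branch a b y y = Some (- 1 / z - 1)"
      using 1 W_bounds[OF z] branch_simps(3)[OF ab, of "- 1 / z"] by simp
    also have "- 1 / z - 1 = - (z + 1) / z" using W_bounds[OF z] by (simp add: field_simps)
    finally have *: "branch a b y y = Some (- (z + 1) / z)" .
    show ?thesis
    proof (cases "good_shift z")
      case True
      then show ?thesis using * z by (auto simp: upper_points_def)
    next
      case False
      then have "- (z + 1) / z = - 1 / next_jump z" by (simp add: next_jump_def add.commute)
      then show ?thesis using * closed[OF z] by (auto simp: upper_points_def)
    qed
  next
    case 2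
    note sb = shift_bounds[OF z 2(1)]
    have "branch a b y y = Some (- 1 / (- (z + 1) / z))"
      unfolding 2(2) using sb b_pos by (intro branch_simps(2)) linarith+
    also have "- 1 / (- (z + 1) / z) = z / (z + 1)" using sb(4) by (simp add: field_simps)
    finally show ?thesis using z 2 by (auto simp: upper_points_def)
  next
    case 3
    note sb = shift_bounds[OF z 3(1)]
    have "branch a b y y = Some (z / (z + 1) - 1)"
      using 3 sb ab by (simp add: branch_simps)
    also have "z / (z + 1) - 1 = - 1 / next_jump z"
      using 3 sb(4) by (simp add: next_jump_def field_simps)
    finally show ?thesis using closed[OF z] by (auto simp: upper_points_def)
  qed
qed

lemma lower_orbit_visits:
  assumes "\<exists>k. orbit_pt (lower_branch a b) x k = Some z" "z \<in> W"
  shows "\<exists>k. orbit_pt (lower_branch a b) x k = Some (next_jump z)"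
proof -
  obtain k where k: "orbit_pt (lower_branch a b) x k = Some z" using assms by blast
  then have 1: "orbit_pt (lower_branch a b) x (Suc k) = Some (z + 1)"
    using W_bounds[OF assms(2)] by (simp add: orbit_pt_Suc lower_branch_simps)
  show ?thesis
  proof (cases "good_shift z")
    case True
    then show ?thesis using 1 by (auto simp: next_jump_def)
  next
    case False
    then have g: "good_farey z" using good assms(2) by blast
    then have "orbit_pt (lower_branch a b) x (Suc (Suc k)) = Some (- 1 / (z + 1))"
      using good_farey_bounds[OF g] by (simp add: orbit_pt_Suc[of _ _ "Suc k"] 1 lower_branch_simps)
    then have "orbit_pt (lower_branch a b) x (Suc (Suc (Suc k))) = Some (- 1 / (z + 1) + 1)"
      using good_farey_bounds[OF g] by (simp add: orbit_pt_Suc[of _ _ "Suc (Suc k)"] lower_branch_simps)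
    also have "- 1 / (z + 1) + 1 = next_jump z"
      using good_farey_bounds[OF g] by (simp add: next_jump_def field_simps)
    finally show ?thesis by blast
  qed
qed

end

text \<open>
  If the jump orbit ends, it is finite. Otherwise it is a set \<open>W\<close> as above that is visited
  completely by the lower orbit of \<open>l\<close>, so that the finiteness of this lower orbit suffices.
\<close>

lemma finite_jump_orbit:
  assumes lower: "\<exists>k. orbit_pt (lower_branch a b) l k = Some z0"
    and endless: "\<And>W. z0 \<in> W \<Longrightarrow> (\<And>z. z \<in> W \<Longrightarrow> good_shift z \<or> good_farey z) \<Longrightarrow>
                 (\<And>z. z \<in> W \<Longrightarrow> next_jump z \<in> W) \<Longrightarrow>
                 finite (range (orbit_pt (lower_branch a b) l))"
  shows "finite (jump_orbit z0)"
proof (cases "\<exists>i. \<not> (good_shift ((next_jump ^^ i) z0) \<or> good_farey ((next_jump ^^ i) z0))")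
  case True
  then obtain i where i: "\<not> (good_shift ((next_jump ^^ i) z0) \<or> good_farey ((next_jump ^^ i) z0))" ..
  have "jump_orbit z0 \<subseteq> (\<lambda>n. (next_jump ^^ n) z0) ` {..i}"
  proof
    fix z assume "z \<in> jump_orbit z0"
    then obtain n where n: "z = (next_jump ^^ n) z0"
      "\<forall>i<n. good_shift ((next_jump ^^ i) z0) \<or> good_farey ((next_jump ^^ i) z0)"
      by (auto simp: jump_orbit_def)
    then have "n \<le> i" using i by (meson not_le)
    then show "z \<in> (\<lambda>n. (next_jump ^^ n) z0) ` {..i}" using n by blast
  qed
  then show ?thesis by (rule finite_subset) simp
next
  case False
  let ?W = "range (\<lambda>n. (next_jump ^^ n) z0)"
  have good: "\<And>z. z \<in> ?W \<Longrightarrow> good_shift z \<or> good_farey z" using False by blast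
  have closed: "next_jump z \<in> ?W" if z: "z \<in> ?W" for z
  proof -
    obtain n where "z = (next_jump ^^ n) z0" using z by blast
    then have "next_jump z = (next_jump ^^ Suc n) z0" by simp
    then show ?thesis by blast
  qed
  have W0: "z0 \<in> ?W" using funpow_0[of next_jump z0] by (metis rangeI)
  have "\<exists>k. orbit_pt (lower_branch a b) l k = Some ((next_jump ^^ n) z0)" for n
    using lower lower_orbit_visits[OF good closed] by (induction n) auto
  then have "Some ` ?W \<subseteq> range (orbit_pt (lower_branch a b) l)" by (auto simp: image_iff) metis
  then have "finite (Some ` ?W)" using endless[OF W0 good closed] finite_subset by blast
  then have "finite ?W" by (rule finite_imageD) simp
  moreover have "jump_orbit z0 \<subseteq> ?W" by (auto simp: jump_orbit_def)
  ultimately show ?thesis by (rule finite_subset[rotated])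
qed

text \<open>
  The breakpoint \<open>1 - 1/b\<close> is the image \<open>T (S b)\<close> on the lower orbit of \<open>b\<close>; if the jump
  orbit is endless, \<open>b - 1\<close> is followed by \<open>1 / (1 - b)\<close> and then by \<open>S (1 - 1/b)\<close> on the upper orbit. An
  endless jump orbit excludes a cycle of \<open>b\<close>, and then the truncated lower orbit is the whole orbit.
\<close>

lemma finite_jump_orbit_b:
  assumes "finiteness_condition a b"
  shows "finite (jump_orbit (1 - 1 / b))"
proof (rule finite_jump_orbit[where l = "mS (Some b)"])
  have l: "mS (Some b) = Some (- 1 / b)" using b_pos by (simp add: mS_def)
  have l1: "orbit_pt (lower_branch a b) (mS (Some b)) 1 = Some (1 - 1 / b)"
    using Sb_le_a by (simp add: orbit_pt_def l lower_branch_simps)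
  then show "\<exists>k. orbit_pt (lower_branch a b) (mS (Some b)) k = Some (1 - 1 / b)" ..
  fix W assume W0: "1 - 1 / b \<in> W" and good: "\<And>z. z \<in> W \<Longrightarrow> good_shift z \<or> good_farey z"
    and closed: "\<And>z. z \<in> W \<Longrightarrow> next_jump z \<in> W"
  note bounds = W_bounds[OF good closed W0]
  have b1: "b < 1" using bounds(3) b_pos by (simp add: field_simps)
  let ?L = "insert (- 1 / b) (lower_points W)" and ?U = "{b - 1, 1 / (1 - b)} \<union> upper_points W"
  have L: "lower_b a b k \<in> Some ` ?L" for k
    unfolding lower_b_def
  proof (rule orbit_pt_closed)
    show "mS (Some b) \<in> Some ` ?L" using l by simp
    fix y assume "y \<in> Some ` ?L"
    then consider "y = Some (- 1 / b)" | "y \<in> Some ` lower_points W" by blast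
    then show "lower_branch a b y y \<in> Some ` ?L"
    proof cases
      case 1
      then have "lower_branch a b y y = Some (1 - 1 / b)"
        using Sb_le_a by (simp add: lower_branch_simps)
      then show ?thesis using W0 by (auto simp: lower_points_def)
    next
      case 2
      then show ?thesis using lower_points_closed[OF good closed 2] by blast
    qed
  qed
  have U: "upper_b a b k \<in> Some ` ?U" for k
    unfolding upper_b_def
  proof (rule orbit_pt_closed)
    show "mTinv (Some b) \<in> Some ` ?U" by (simp add: mTinv_def)
    fix y assume "y \<in> Some ` ?U"
    then consider "y = Some (b - 1)" | "y = Some (1 / (1 - b))" | "y \<in> Some ` upper_points W" by blast
    then show "branch a b y y \<in> Some ` ?U"
    proof cases
      case 1
      have "branch a b y y = Some (- 1 / (b - 1))"
        unfolding 1 using ab_diff b1 by (intro branch_simps(2)) auto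
      also have "- 1 / (b - 1) = 1 / (1 - b)" using b1 by (simp add: field_simps)
      finally show ?thesis by simp
    next
      case 2
      have "1 < 1 / (1 - b)" using b1 b_pos by (simp add: field_simps)
      then have "branch a b y y = Some (1 / (1 - b) - 1)"
        unfolding 2 using b1 a_neg b_pos by (intro branch_simps(3)) linarith+
      also have "1 / (1 - b) - 1 = - 1 / (1 - 1 / b)" using b1 b_pos by (simp add: field_simps)
      finally show ?thesis using W0 unfolding upper_points_def by blast
    next
      case 3
      then show ?thesis using upper_points_closed[OF good closed 3] by blast
    qed
  qed
  have "- 1 / b < a" using bounds by linarith
  then have Lr: "y < a \<or> 0 < y \<and> y \<le> b" if "y \<in> ?L" for y
    using that lower_points_range[OF good closed] by auto
  have "1 < 1 / (1 - b)" using b1 b_pos by (simp add: field_simps)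
  then have "b < 1 / (1 - b)" using b1 by linarith
  then have Ur: "a \<le> y \<and> y < 0 \<or> b < y" if "y \<in> ?U" for y
    using that upper_points_range[OF good closed] b1 ab_diff by auto
  have disj: "Some ` ?U \<inter> Some ` ?L = {}" using Lr Ur a_neg b_pos by fastforce
  have "\<not> has_cycle (upper_b a b) (lower_b a b)"
  proof
    assume "has_cycle (upper_b a b) (lower_b a b)"
    then obtain m k where "upper_b a b m = lower_b a b k" by (auto simp: has_cycle_def)
    then show False using L[of k] U[of m] disj by (metis IntI empty_iff)
  qed
  then show "finite (range (orbit_pt (lower_branch a b) (mS (Some b))))"
    using assms
    by (auto simp: finiteness_condition_def trunc_L_b_def truncated_orbit_def lower_b_def)
qed

text \<open>
  The breakpoint \<open>a / (1 + a)\<close> is the point \<open>T S T a\<close> on the lower orbit of \<open>a\<close>, and its image under \<open>S\<close>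
  is the point \<open>T\<^sup>-\<^sup>1 S a\<close> on the upper orbit of \<open>a\<close>.
\<close>

lemma finite_jump_orbit_a:
  assumes "finiteness_condition a b" "- 1 < a"
  shows "finite (jump_orbit (a / (1 + a)))"
proof (rule finite_jump_orbit[where l = "mT (Some a)"])
  have l: "mT (Some a) = Some (a + 1)" by (simp add: mT_def)
  have S: "lower_branch a b (Some (a + 1)) (Some (a + 1)) = Some (- 1 / (a + 1))"
    using assms(2) ab_diff by (intro lower_branch_simps) auto
  have le: "- 1 / (a + 1) \<le> - 1 / b" using assms(2) ab_diff by (simp add: field_simps)
  have T: "lower_branch a b (Some (- 1 / (a + 1))) (Some (- 1 / (a + 1))) = Some (a / (1 + a))"
  proof -
    have "lower_branch a b (Some (- 1 / (a + 1))) (Some (- 1 / (a + 1))) = Some (- 1 / (a + 1) + 1)"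
      using le Sb_le_a by (intro lower_branch_simps) linarith
    also have "- 1 / (a + 1) + 1 = a / (1 + a)" using assms(2) by (simp add: field_simps)
    finally show ?thesis .
  qed
  have "orbit_pt (lower_branch a b) (mT (Some a)) (Suc (Suc 0)) = Some (a / (1 + a))"
    by (simp only: orbit_pt_Suc orbit_pt_0 l S T)
  then show "\<exists>k. orbit_pt (lower_branch a b) (mT (Some a)) k = Some (a / (1 + a))" ..
  fix W assume W0: "a / (1 + a) \<in> W" and good: "\<And>z. z \<in> W \<Longrightarrow> good_shift z \<or> good_farey z"
    and closed: "\<And>z. z \<in> W \<Longrightarrow> next_jump z \<in> W"
  note bounds = W_bounds[OF good closed W0]
  let ?L = "{a + 1, - 1 / (a + 1)} \<union> lower_points W" and ?U = "insert (- 1 / a) (upper_points W)"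
  have L: "lower_a a b k \<in> Some ` ?L" for k
    unfolding lower_a_def
  proof (rule orbit_pt_closed)
    show "mT (Some a) \<in> Some ` ?L" using l by simp
    fix y assume "y \<in> Some ` ?L"
    then consider "y = Some (a + 1)" | "y = Some (- 1 / (a + 1))" | "y \<in> Some ` lower_points W" by blast
    then show "lower_branch a b y y \<in> Some ` ?L"
    proof cases
      case 1
      then show ?thesis using S by simp
    next
      case 2
      then show ?thesis using W0 T by (auto simp: lower_points_def)
    next
      case 3
      then show ?thesis using lower_points_closed[OF good closed 3] by blast
    qed
  qed
  have "- 1 / b < a" using bounds by linarith
  then have Sa: "b < - 1 / a" using a_neg b_pos by (simp add: field_simps)
  have U: "upper_a a b k \<in> Some ` ?U" for k
    unfolding upper_a_def
  proof (rule orbit_pt_closed)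
    show "mS (Some a) \<in> Some ` ?U" using a_neg by (simp add: mS_def)
    fix y assume "y \<in> Some ` ?U"
    then consider "y = Some (- 1 / a)" | "y \<in> Some ` upper_points W" by blast
    then show "branch a b y y \<in> Some ` ?U"
    proof cases
      case 1
      have "branch a b y y = Some (- 1 / a - 1)"
        unfolding 1 using Sa a_neg b_pos by (intro branch_simps(3)) linarith+
      also have "- 1 / a - 1 = - 1 / (a / (1 + a))" using a_neg assms(2) by (simp add: field_simps)
      finally show ?thesis using W0 unfolding upper_points_def by blast
    next
      case 2
      then show ?thesis using upper_points_closed[OF good closed 2] by blast
    qed
  qed
  have Lr: "y < a \<or> 0 < y \<and> y \<le> b" if "y \<in> ?L" for y
    using that lower_points_range[OF good closed] le \<open>- 1 / b < a\<close> assms(2) ab_diff by auto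
  have Ur: "a \<le> y \<and> y < 0 \<or> b < y" if "y \<in> ?U" for y
    using that upper_points_range[OF good closed] Sa by auto
  have disj: "Some ` ?U \<inter> Some ` ?L = {}" using Lr Ur a_neg b_pos by fastforce
  have "\<not> has_cycle (upper_a a b) (lower_a a b)"
  proof
    assume "has_cycle (upper_a a b) (lower_a a b)"
    then obtain m k where "upper_a a b m = lower_a a b k" by (auto simp: has_cycle_def)
    then show False using L[of k] U[of m] disj by (metis IntI empty_iff)
  qed
  then show "finite (range (orbit_pt (lower_branch a b) (mT (Some a))))"
    using assms
    by (auto simp: finiteness_condition_def trunc_L_a_def truncated_orbit_def lower_a_def)
qed

section \<open>The Farey recursion on the fundamental interval\<close>

definition boundary_step :: "(real \<Rightarrow> real) \<Rightarrow> real \<Rightarrow> real" where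
  "boundary_step g p =
     (if - 1 / b \<le> p - 1 then g (p - 1) + 1
      else if p / (1 - p) < a then g (p / (1 - p)) / (1 + g (p / (1 - p))) else 1)"

definition phi_approx :: "nat \<Rightarrow> real \<Rightarrow> real" where
  "phi_approx n = (boundary_step ^^ n) (\<lambda>_. 0)"

lemma phi_approx_0: "phi_approx 0 p = 0" and phi_approx_Suc: "phi_approx (Suc n) p = boundary_step (phi_approx n) p"
  by (auto simp: phi_approx_def)

text \<open>
  This is where \<open>b - a \<ge> 1\<close> enters: a point that can be shifted to the left inside \<open>[S b, a)\<close> is mapped
  by the other move beyond \<open>b - 1 \<ge> a\<close>.
\<close>

lemma shift_excludes_farey:
  assumes "- 1 / b \<le> p - 1" "p < a"
  shows "a \<le> p / (1 - p)"
proof -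
  have "b - 1 \<le> b * p" using assms(1) b_pos by (simp add: field_simps)
  then have "b - 1 \<le> p / (1 - p)" using assms(2) a_neg by (simp add: field_simps)
  then show ?thesis using ab_diff by linarith
qed

lemma phi_approx_nonneg: "0 \<le> phi_approx n p"
  by (induction n arbitrary: p) (auto simp: phi_approx_0 phi_approx_Suc boundary_step_def add_nonneg_nonneg)

lemma frac_mono: "0 \<le> t \<Longrightarrow> t \<le> u \<Longrightarrow> t / (1 + t) \<le> u / (1 + (u::real))"
  by (simp add: field_simps)

lemma frac_less_1: "0 \<le> t \<Longrightarrow> t / (1 + t) \<le> (1::real)"
  by (simp add: field_simps)

lemma phi_approx_incseq: "phi_approx n p \<le> phi_approx (Suc n) p"
proof (induction n arbitrary: p)
  case 0
  then show ?case using phi_approx_nonneg[of "Suc 0" p] by (simp add: phi_approx_0)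
next
  case (Suc n)
  show ?case
    unfolding phi_approx_Suc[of "Suc n"] phi_approx_Suc[of n p]
    using Suc[of "p - 1"] frac_mono[OF phi_approx_nonneg Suc[of "p / (1 - p)"]]
    by (simp add: boundary_step_def)
qed

text \<open>
  The bound is compatible with the shift, because \<open>p\<close> decreases by one when the value
  increases by one; the other cases give values at most one.
\<close>

lemma phi_approx_bounded: "- 1 / b \<le> p \<Longrightarrow> phi_approx n p \<le> p + 1 / b + 1"
proof (induction n arbitrary: p)
  case (Suc n)
  then show ?case
    using Suc.IH[of "p - 1"] frac_less_1[OF phi_approx_nonneg, of n "p / (1 - p)"]
    by (auto simp: phi_approx_Suc boundary_step_def)
qed (simp add: phi_approx_0)

lemma phi_approx_mono: "- 1 / b \<le> p \<Longrightarrow> p \<le> q \<Longrightarrow> q < a \<Longrightarrow> phi_approx n p \<le> phi_approx n q"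
proof (induction n arbitrary: p q)
  case (Suc n)
  have q1: "q < 1" using Suc.prems a_neg by linarith
  show ?case
  proof (cases "- 1 / b \<le> q - 1")
    case True
    show ?thesis
    proof (cases "- 1 / b \<le> p - 1")
      case P: True
      then show ?thesis
        using True Suc.IH[of "p - 1" "q - 1"] Suc.prems by (simp add: phi_approx_Suc boundary_step_def)
    next
      case False
      then have "phi_approx (Suc n) p \<le> 1"
        using frac_less_1[OF phi_approx_nonneg, of n "p / (1 - p)"] by (simp add: phi_approx_Suc boundary_step_def)
      moreover have "1 \<le> phi_approx (Suc n) q"
        using True phi_approx_nonneg[of n "q - 1"] by (simp add: phi_approx_Suc boundary_step_def)
      ultimately show ?thesis by linarith
    qed
  next
    case False
    then have P: "\<not> - 1 / b \<le> p - 1" using Suc.prems by linarith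
    show ?thesis
    proof (cases "q / (1 - q) < a")
      case True
      have le: "p / (1 - p) \<le> q / (1 - q)" using farey_mono Suc.prems q1 by blast
      have "- 1 / b \<le> p / (1 - p)" using farey_ge[of p] Suc.prems q1 by linarith
      then have "phi_approx n (p / (1 - p)) \<le> phi_approx n (q / (1 - q))" using Suc.IH le True by blast
      then show ?thesis
        using False P True le frac_mono[OF phi_approx_nonneg] by (simp add: phi_approx_Suc boundary_step_def)
    next
      case nF: False
      then have "phi_approx (Suc n) q = 1" using False by (simp add: phi_approx_Suc boundary_step_def)
      moreover have "phi_approx (Suc n) p \<le> 1"
        using P frac_less_1[OF phi_approx_nonneg, of n "p / (1 - p)"] by (simp add: phi_approx_Suc boundary_step_def)
      ultimately show ?thesis by simp
    qed
  qed
qed (simp add: phi_approx_0)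

definition phi :: "real \<Rightarrow> real" where
  "phi p = lim (\<lambda>n. phi_approx n p)"

lemma phi_approx_tendsto: "- 1 / b \<le> p \<Longrightarrow> (\<lambda>n. phi_approx n p) \<longlonglongrightarrow> phi p"
proof -
  assume p: "- 1 / b \<le> p"
  have "incseq (\<lambda>n. phi_approx n p)" using phi_approx_incseq by (rule incseq_SucI)
  then obtain L where "(\<lambda>n. phi_approx n p) \<longlonglongrightarrow> L"
    using incseq_convergent[of "\<lambda>n. phi_approx n p"] phi_approx_bounded[OF p] by blast
  then show ?thesis unfolding phi_def by (simp add: limI)
qed

lemma phi_nonneg: "- 1 / b \<le> p \<Longrightarrow> 0 \<le> phi p"
  using LIMSEQ_le_const[OF phi_approx_tendsto] phi_approx_nonneg by blast

lemma phi_mono: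
  assumes "- 1 / b \<le> p" "p \<le> q" "q < a"
  shows "phi p \<le> phi q"
proof (rule LIMSEQ_le)
  show "(\<lambda>n. phi_approx n p) \<longlonglongrightarrow> phi p" "(\<lambda>n. phi_approx n q) \<longlonglongrightarrow> phi q"
    using assms by (auto intro: phi_approx_tendsto)
  show "\<exists>N. \<forall>n\<ge>N. phi_approx n p \<le> phi_approx n q" using phi_approx_mono[OF assms] by blast
qed

lemma phi_fixed:
  assumes "- 1 / b \<le> p" "p < a"
  shows "phi p = boundary_step phi p"
proof -
  have "(\<lambda>n. boundary_step (phi_approx n) p) \<longlonglongrightarrow> boundary_step phi p"
  proof -
    have "- 1 / b \<le> p / (1 - p)" using farey_ge[of p] assms a_neg by linarith
    then have "(\<lambda>n. phi_approx n (p / (1 - p))) \<longlonglongrightarrow> phi (p / (1 - p))" "0 \<le> phi (p / (1 - p))"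
      using phi_approx_tendsto phi_nonneg by auto
    then have "(\<lambda>n. phi_approx n (p / (1 - p)) / (1 + phi_approx n (p / (1 - p))))
                 \<longlonglongrightarrow> phi (p / (1 - p)) / (1 + phi (p / (1 - p)))"
      by (intro tendsto_intros) auto
    moreover have "(\<lambda>n. phi_approx n (p - 1) + 1) \<longlonglongrightarrow> phi (p - 1) + 1" if "- 1 / b \<le> p - 1"
      using phi_approx_tendsto[OF that] by (intro tendsto_intros)
    ultimately show ?thesis by (simp add: boundary_step_def)
  qed
  then have "(\<lambda>n. phi_approx (Suc n) p) \<longlonglongrightarrow> boundary_step phi p" by (simp add: phi_approx_Suc)
  moreover have "(\<lambda>n. phi_approx (Suc n) p) \<longlonglongrightarrow> phi p"
    using phi_approx_tendsto[OF assms(1)] by (rule LIMSEQ_Suc)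
  ultimately show ?thesis by (rule LIMSEQ_unique[symmetric])
qed

text \<open>
  Each application of the second case increases \<open>S p\<close> by one, and \<open>S p\<close> stays below \<open>S a\<close>. So
  after finitely many steps another case applies, and there the value is at least one. The number \<open>k\<close> bounds
  the number of these steps.
\<close>

lemma phi_pos:
  assumes "- 1 / b \<le> p" "p < a"
  shows "0 < phi p"
proof -
  have "0 < phi p" if "- 1 / b \<le> p" "p < a" "- 1 / a - real k \<le> - 1 / p" for k p
    using that
  proof (induction k arbitrary: p)
    case 0
    then show ?case using a_neg by (simp add: field_simps)
  next
    case (Suc k)
    have p: "p < 0" using Suc.prems a_neg by linarith
    show ?case
    proof (cases "- 1 / b \<le> p - 1")
      case True
      then show ?thesis
        using phi_fixed[of p] phi_nonneg[OF True] Suc.prems by (simp add: boundary_step_def)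
    next
      case False
      show ?thesis
      proof (cases "p / (1 - p) < a")
        case True
        have "- 1 / (p / (1 - p)) = - 1 / p + 1" using p by (simp add: field_simps)
        moreover have "- 1 / b \<le> p / (1 - p)" using farey_ge[of p] Suc.prems p by linarith
        ultimately have "0 < phi (p / (1 - p))" using Suc.IH[OF _ True] Suc.prems(3) by simp
        then show ?thesis
          using phi_fixed[of p] True False Suc.prems by (simp add: boundary_step_def)
      next
        case nF: False
        then show ?thesis
          using phi_fixed[of p] False Suc.prems by (simp add: boundary_step_def)
      qed
    qed
  qed
  moreover obtain k where k: "- 1 / a + 1 / p \<le> real k" using real_arch_simple by blast
  from k have "- 1 / a - real k \<le> - 1 / p" by simp
  ultimately show ?thesis using assms by blast
qed

text \<open>
  If no point of the set \<open>Z\<close> separates \<open>p\<close> from \<open>q\<close>, the recursion treats \<open>p\<close> and \<open>q\<close> alike,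
  and the two new points are again not separated: a separating point would be moved by \<open>next_jump\<close> to a
  point of \<open>Z\<close> between \<open>p\<close> and \<open>q\<close>. Separation is read as \<open>p < z \<le> q\<close> to match the half-open cases of the
  recursion.
\<close>

lemma phi_approx_constant:
  assumes Z: "1 - 1 / b \<in> Z" "- 1 < a \<Longrightarrow> a / (1 + a) \<in> Z"
    and Z_closed: "\<And>z. z \<in> Z \<Longrightarrow> good_shift z \<or> good_farey z \<Longrightarrow> next_jump z \<in> Z"
  shows "- 1 / b \<le> p \<Longrightarrow> p \<le> q \<Longrightarrow> q < a \<Longrightarrow> (\<And>z. z \<in> Z \<Longrightarrow> \<not> (p < z \<and> z \<le> q)) \<Longrightarrow> phi_approx n p = phi_approx n q"
proof (induction n arbitrary: p q)
  case (Suc n)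
  note p = Suc.prems(1) and pq = Suc.prems(2) and q = Suc.prems(3) and noZ = Suc.prems(4)
  have shift: "- 1 / b \<le> q - 1 \<longleftrightarrow> - 1 / b \<le> p - 1"
    using noZ[OF Z(1)] pq by linarith
  have p1: "p < 0" "q < 0" using pq q a_neg by auto
  have farey: "q / (1 - q) < a \<longleftrightarrow> p / (1 - p) < a"
  proof (cases "- 1 < a")
    case True
    have "r / (1 - r) < a \<longleftrightarrow> r < a / (1 + a)" if "r < 0" for r
      using that True by (simp add: field_simps)
    from this[OF p1(1)] this[OF p1(2)] show ?thesis using noZ[OF Z(2)[OF True]] pq by linarith
  next
    case False
    have "- 1 < r / (1 - r)" if "r < 0" for r :: real using that by (simp add: pos_less_divide_eq)
    from this[OF p1(1)] this[OF p1(2)] show ?thesis using False by linarith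
  qed
  show ?case
  proof (cases "- 1 / b \<le> p - 1")
    case True
    have "phi_approx n (p - 1) = phi_approx n (q - 1)"
    proof (rule Suc.IH)
      fix z assume z: "z \<in> Z"
      show "\<not> (p - 1 < z \<and> z \<le> q - 1)"
      proof
        assume 1: "p - 1 < z \<and> z \<le> q - 1"
        then have "good_shift z" using True q by (auto simp: good_shift_def)
        then have "z + 1 \<in> Z" using Z_closed[OF z] by (simp add: next_jump_def)
        then show False using noZ[of "z + 1"] 1 by linarith
      qed
    qed (use True pq q in auto)
    then show ?thesis using True shift by (simp add: phi_approx_Suc boundary_step_def)
  next
    case nS: False
    show ?thesis
    proof (cases "p / (1 - p) < a")
      case True
      have "phi_approx n (p / (1 - p)) = phi_approx n (q / (1 - q))"
      proof (rule Suc.IH)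
        show "- 1 / b \<le> p / (1 - p)" using farey_ge[of p] p1 p by linarith
        show "p / (1 - p) \<le> q / (1 - q)" using farey_mono pq p1 by auto
        show "q / (1 - q) < a" using True farey by blast
        fix z assume z: "z \<in> Z"
        show "\<not> (p / (1 - p) < z \<and> z \<le> q / (1 - q))"
        proof
          assume 1: "p / (1 - p) < z \<and> z \<le> q / (1 - q)"
          have "- 1 / (b + 1) = (- 1 / b) / (1 - (- 1 / b))" using b_pos by (simp add: field_simps)
          also have "\<dots> \<le> p / (1 - p)" using farey_mono[OF p] p1 by linarith
          finally have g: "good_farey z" using 1 True farey unfolding good_farey_def by linarith
          then have zp: "- 1 < z" "\<not> good_shift z" using good_farey_bounds by auto
          then have "z / (1 + z) \<in> Z" using Z_closed[OF z] g by (simp add: next_jump_def)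
          moreover have "p < z / (1 + z)"
          proof -
            have "p < z * (1 - p)" using 1 p1 by (simp add: pos_divide_less_eq)
            then have "p * (1 + z) < z" by (simp add: algebra_simps)
            then show ?thesis using zp by (simp add: pos_less_divide_eq)
          qed
          moreover have "z / (1 + z) \<le> q"
          proof -
            have "z * (1 - q) \<le> q" using 1 p1 by (simp add: pos_le_divide_eq)
            then have "z \<le> q * (1 + z)" by (simp add: algebra_simps)
            then show ?thesis using zp by (simp add: pos_divide_le_eq)
          qed
          ultimately show False using noZ by blast
        qed
      qed
      then show ?thesis using nS True farey shift by (simp add: phi_approx_Suc boundary_step_def)
    next
      case False
      then show ?thesis using nS farey shift by (simp add: phi_approx_Suc boundary_step_def)
    qed
  qed
qed (simp add: phi_approx_0)

lemma finite_phi_image: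
  assumes "finite Z" "1 - 1 / b \<in> Z" "- 1 < a \<Longrightarrow> a / (1 + a) \<in> Z"
    and "\<And>z. z \<in> Z \<Longrightarrow> good_shift z \<or> good_farey z \<Longrightarrow> next_jump z \<in> Z"
  shows "finite (phi ` {- 1 / b..<a})"
proof -
  let ?J = "{- 1 / b..<a}"
  define key where "key p = {z \<in> Z. z \<le> p}" for p
  have le: "phi p = phi q" if "p \<in> ?J" "q \<in> ?J" "key p = key q" "p \<le> q" for p q
  proof -
    have "\<not> (p < z \<and> z \<le> q)" if "z \<in> Z" for z
    proof
      assume "p < z \<and> z \<le> q"
      then have "z \<in> key q" "z \<notin> key p" using that by (auto simp: key_def)
      then show False using \<open>key p = key q\<close> by simp
    qed
    then have "phi_approx n p = phi_approx n q" for n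
      using that(1,2,4) by (intro phi_approx_constant[OF assms(2,3,4)]) auto
    then show ?thesis by (simp only: phi_def)
  qed
  have eq: "phi p = phi q" if "p \<in> ?J" "q \<in> ?J" "key p = key q" for p q
  proof (cases "p \<le> q")
    case True
    then show ?thesis by (rule le[OF that])
  next
    case False
    then show ?thesis using le[OF that(2,1) that(3)[symmetric]] by simp
  qed
  \<comment> \<open>a value of phi depends only on the points of Z to the left of its argument\<close>
  have "phi ` ?J \<subseteq> (\<lambda>T. phi (SOME p. p \<in> ?J \<and> key p = T)) ` Pow Z"
  proof
    fix t assume "t \<in> phi ` ?J"
    then obtain p where p: "p \<in> ?J" "t = phi p" by blast
    let ?q = "SOME q. q \<in> ?J \<and> key q = key p"
    have "?q \<in> ?J \<and> key ?q = key p" by (rule someI_ex) (use p in blast)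
    then have "t = phi ?q" using eq[of p ?q] p by simp
    moreover have "key p \<in> Pow Z" by (auto simp: key_def)
    ultimately show "t \<in> (\<lambda>T. phi (SOME p. p \<in> ?J \<and> key p = T)) ` Pow Z" by blast
  qed
  moreover have "finite ((\<lambda>T. phi (SOME p. p \<in> ?J \<and> key p = T)) ` Pow Z)" using assms(1) by simp
  ultimately show ?thesis by (rule finite_subset)
qed

lemma finite_phi:
  assumes "finiteness_condition a b"
  shows "finite (phi ` {- 1 / b..<a})"
proof -
  let ?Z = "jump_orbit (1 - 1 / b) \<union> (if - 1 < a then jump_orbit (a / (1 + a)) else {})"
  show ?thesis
  proof (rule finite_phi_image[of ?Z])
    show "finite ?Z" using finite_jump_orbit_a finite_jump_orbit_b assms by simp
    show "1 - 1 / b \<in> ?Z" using jump_orbit_start by blast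
    show "a / (1 + a) \<in> ?Z" if "- 1 < a" using that jump_orbit_start by simp
    fix z assume z: "z \<in> ?Z" "good_shift z \<or> good_farey z"
    show "next_jump z \<in> ?Z"
    proof (cases "z \<in> jump_orbit (1 - 1 / b)")
      case True
      then show ?thesis using jump_orbit_next z(2) by blast
    next
      case False
      then have "- 1 < a" "z \<in> jump_orbit (a / (1 + a))" using z(1) by (auto split: if_splits)
      then show ?thesis using jump_orbit_next[OF _ z(2)] by simp
    qed
  qed
qed

end

section \<open>The boundary of the lower region\<close>

text \<open>
  The reflection \<open>y \<mapsto> -y\<close> exchanges the strict and the weak order. The flag allows the
  lower region to be treated for both conventions simultaneously.
\<close>

definition below :: "bool \<Rightarrow> real \<Rightarrow> real \<Rightarrow> bool" where
  "below s y c \<longleftrightarrow> (if s then y < c else y \<le> c)"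

lemma below_shift: "below s (y - 1) c \<longleftrightarrow> below s y (c + 1)"
  by (auto simp: below_def)

lemma below_uminus: "below (\<not> s) (- y) (- c) \<longleftrightarrow> \<not> below s y c"
  by (auto simp: below_def)

lemma below_mono: "below s y c \<Longrightarrow> z \<le> y \<Longrightarrow> c \<le> d \<Longrightarrow> below s z d"
  by (auto simp: below_def split: if_splits)

lemma below_imp_le: "below s y c \<Longrightarrow> y \<le> c"
  by (auto simp: below_def split: if_splits)

lemma not_below_imp_ge: "\<not> below s y c \<Longrightarrow> c \<le> y"
  by (auto simp: below_def split: if_splits)

lemma below_less: "y < c \<Longrightarrow> below s y c"
  by (auto simp: below_def)

lemma not_below_greater: "c < y \<Longrightarrow> \<not> below s y c"
  by (auto simp: below_def)

lemma below_inverse_neg: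
  assumes "y < 0" "c > 0"
  shows "below s y (- 1 / c) \<longleftrightarrow> below s (- 1 / y) c"
  using assms by (auto simp: below_def field_simps)

lemma below_inverse_same:
  assumes "y < 0" "c < 0"
  shows "below (\<not> s) (1 / y) (1 / c) \<longleftrightarrow> \<not> below s y c"
  using assms by (auto simp: below_def field_simps)

text \<open>
  With \<open>s = True\<close> the conditions on \<open>p\<close> say that \<open>p\<close> belongs to \<open>[S b, a)\<close>, with \<open>s = False\<close> that it
  belongs to \<open>(S b, a]\<close>. The recursion for \<open>\<phi>\<close> is self-dual under reflection.
\<close>

locale boundary_data = parameters a b for a b :: real +
  fixes s :: bool and \<phi> :: "real \<Rightarrow> real"
  assumes \<phi>_pos: "\<And>p. \<not> below s p (- 1 / b) \<Longrightarrow> below s p a \<Longrightarrow> 0 < \<phi> p"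
    and \<phi>_mono: "\<And>p q. \<not> below s p (- 1 / b) \<Longrightarrow> below s q a \<Longrightarrow> p \<le> q \<Longrightarrow> \<phi> p \<le> \<phi> q"
    and \<phi>_finite: "finite (\<phi> ` {p. \<not> below s p (- 1 / b) \<and> below s p a})"
    and \<phi>_shift: "\<And>p. \<not> below s (p - 1) (- 1 / b) \<Longrightarrow> below s p a \<Longrightarrow> \<phi> p = \<phi> (p - 1) + 1"
    and \<phi>_farey: "\<And>p. \<not> below s p (- 1 / b) \<Longrightarrow> below s (p / (1 - p)) a \<Longrightarrow>
                    below s p a \<Longrightarrow> 1 / \<phi> p = 1 / \<phi> (p / (1 - p)) + 1"
    and \<phi>_base: "\<And>p. \<not> below s p (- 1 / b) \<Longrightarrow> below s p a \<Longrightarrow> below s (p - 1) (- 1 / b) \<Longrightarrow>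
                    \<not> below s (p / (1 - p)) a \<Longrightarrow> \<phi> p = 1"
begin

definition core :: "real set" where
  "core = {p. \<not> below s p (- 1 / b) \<and> below s p a}"

text \<open>
  Evaluated at \<open>v = S y - 1\<close> for \<open>y < S b\<close>. If such a \<open>v\<close> lies to the left of the fundamental interval,
  then \<open>v > - 1\<close>, so that \<open>S v > 1 > a + 1\<close> and the boundary over \<open>v\<close> is \<open>S \<infinity> = 0\<close>.
\<close>

definition ext_\<phi> :: "real \<Rightarrow> real" where
  "ext_\<phi> v = (if v \<in> core then \<phi> v else 0)"

text \<open>
  The lower boundary for levels below \<open>a\<close>. A level \<open>y < S b\<close> receives its boundary from the level
  \<open>S y\<close>, which in turn receives it from \<open>S y - 1\<close> by a shift. If \<open>S y \<ge> a + 1\<close>, the lower region has no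
  points over \<open>S y\<close>; its boundary there is \<open>\<infinity>\<close>, and \<open>S \<infinity> = 0\<close>.
\<close>

definition low_left :: "real \<Rightarrow> real" where
  "low_left y = (if \<not> below s y (- 1 / b) then \<phi> y
             else if below s (- 1 / y - 1) a then - 1 / (1 + ext_\<phi> (- 1 / y - 1)) else 0)"

definition low :: "real \<Rightarrow> real" where
  "low y = (if below s y a then low_left y else 1 + low_left (y - 1))"

lemma below_a_neg: "below s y a \<Longrightarrow> y < 0"
  using a_neg below_imp_le by fastforce

lemma below_Sb_a: "below s y (- 1 / b) \<Longrightarrow> below s y a"
  by (rule below_mono[OF _ order_refl Sb_le_a])

lemma ext_\<phi>_nonneg: "0 \<le> ext_\<phi> v"
  using \<phi>_pos by (auto simp: ext_\<phi>_def core_def less_imp_le)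

lemma ext_\<phi>_mono: "u \<le> v \<Longrightarrow> below s v a \<Longrightarrow> ext_\<phi> u \<le> ext_\<phi> v"
proof -
  assume *: "u \<le> v" "below s v a"
  show ?thesis
  proof (cases "u \<in> core")
    case True
    then have "v \<in> core"
      using * below_mono[of s v "- 1 / b" u "- 1 / b"] by (auto simp: core_def)
    then show ?thesis using True * \<phi>_mono by (auto simp: ext_\<phi>_def core_def)
  next
    case False
    then show ?thesis using ext_\<phi>_nonneg[of v] by (simp add: ext_\<phi>_def)
  qed
qed

lemma below_Sb_neg: "below s y (- 1 / b) \<Longrightarrow> y < 0"
  using below_a_neg below_Sb_a by blast

lemma S_pred: "y < 1 \<Longrightarrow> - 1 / (y - 1) - 1 = y / (1 - (y::real))"
  by (simp add: field_simps)

lemma low_pred_below_Sb: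
  assumes "below s (y - 1) (- 1 / b)" "\<not> below s y a" "below s y (a + 1)"
  shows "low (y - 1) = 0"
proof -
  have y1: "y < 1"
    using assms(3) below_imp_le a_neg by fastforce
  have "\<not> below s (y / (1 - y)) a"
    using assms(2) below_mono[of s "y / (1 - y)" a y a] farey_ge[OF y1] by blast
  then show ?thesis
    using assms below_Sb_a[OF assms(1)] S_pred[OF y1] by (simp add: low_def low_left_def)
qed

text \<open>
  On the fundamental interval this is the recursion for \<open>\<phi>\<close>: if \<open>y - 1\<close> lies to the left of the
  interval, \<open>low (y - 1)\<close> is computed from \<open>S (y - 1) - 1 = y / (1 - y)\<close>.
\<close>

lemma low_shift:
  assumes "\<not> below s y (- 1 / b)" "below s y (a + 1)"
  shows "low y = 1 + low (y - 1)"
proof -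
  have ya: "below s (y - 1) a" using assms(2) by (simp add: below_shift)
  show ?thesis
  proof (cases "below s y a")
    case False
    then show ?thesis using ya by (simp add: low_def)
  next
    case True
    have y0: "y < 0" by (rule below_a_neg[OF True])
    show ?thesis
    proof (cases "below s (y - 1) (- 1 / b)")
      case False
      then show ?thesis using True assms ya \<phi>_shift[of y] by (simp add: low_def low_left_def)
    next
      case B: True
      show ?thesis
      proof (cases "below s (y / (1 - y)) a")
        case F: True
        let ?v = "y / (1 - y)"
        have "\<not> below s ?v (- 1 / b)"
          using assms(1) below_mono[of s ?v "- 1 / b" y "- 1 / b"] farey_ge[of y] y0 by auto
        then have v: "?v \<in> core" using F by (simp add: core_def)
        then have pos: "0 < \<phi> ?v" "0 < \<phi> y" using \<phi>_pos assms(1) True by (auto simp: core_def)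
        have "1 / \<phi> y = 1 / \<phi> ?v + 1" using \<phi>_farey assms(1) F True by blast
        then have "\<phi> y = 1 + - 1 / (1 + \<phi> ?v)" using pos by (simp add: field_simps)
        then show ?thesis
          using True assms ya B F v S_pred[of y] y0 by (simp add: low_def low_left_def ext_\<phi>_def)
      next
        case F: False
        then show ?thesis
          using True assms ya B \<phi>_base[of y] S_pred[of y] y0 by (simp add: low_def low_left_def)
      qed
    qed
  qed
qed

text \<open>
  The left part of the arc over \<open>y < S b\<close> is the \<open>S\<close>-image of the lower part over \<open>S y\<close>.
\<close>

lemma low_below_Sb_cases:
  assumes "below s y (- 1 / b)"
  shows "low y = (if below s (- 1 / y) (a + 1) then - 1 / low (- 1 / y) else 0)"
proof -
  have y0: "y < 0" and ya: "below s y a" using assms below_Sb_neg below_Sb_a by auto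
  let ?v = "- 1 / y - 1"
  show ?thesis
  proof (cases "below s ?v a")
    case False
    then show ?thesis using assms ya by (simp add: low_def low_left_def below_shift)
  next
    case True
    have "- 1 / y > 0" using y0 by (simp add: field_simps)
    then have "\<not> below s (- 1 / y) (- 1 / b)"
      using b_pos by (intro not_below_greater) (auto intro: less_trans[of _ 0])
    then have 1: "low (- 1 / y) = 1 + low ?v"
      using True low_shift by (simp add: below_shift)
    have "low ?v = ext_\<phi> ?v"
    proof (cases "?v \<in> core")
      case False
      then have B: "below s ?v (- 1 / b)" using True by (simp add: core_def)
      have "- 1 < ?v" "?v < 0" using y0 below_a_neg[OF True] by (auto simp: field_simps)
      then have "0 < - 1 / ?v - 1" by (simp add: field_simps)
      then have "\<not> below s (- 1 / ?v - 1) a" using a_neg not_below_greater by auto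
      then show ?thesis using True False B by (simp add: low_def low_left_def ext_\<phi>_def)
    qed (use True in \<open>auto simp: low_def low_left_def ext_\<phi>_def core_def\<close>)
    then show ?thesis using 1 assms ya True by (simp add: low_def low_left_def below_shift)
  qed
qed

lemma low_below_Sb_bounds:
  assumes "below s y (- 1 / b)"
  shows "- 1 \<le> low y" "low y \<le> 0"
  using assms below_Sb_a[OF assms] ext_\<phi>_nonneg[of "- 1 / y - 1"]
  by (auto simp: low_def low_left_def divide_simps)

lemma low_ge_minus1: "below s y a \<Longrightarrow> - 1 \<le> low y"
  using low_below_Sb_bounds(1) \<phi>_pos by (cases "below s y (- 1 / b)") (force simp: low_def low_left_def)+

lemma low_ge_1:
  assumes "\<not> below s y a" "below s y (a + 1)"
  shows "1 \<le> low y"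
proof -
  have nb: "\<not> below s y (- 1 / b)" using assms(1) below_Sb_a by blast
  show ?thesis
  proof (cases "below s (y - 1) (- 1 / b)")
  case True
  then have "low (y - 1) = 0" using low_pred_below_Sb assms by blast
  then show ?thesis using low_shift[OF nb assms(2)] by simp
next
  case False
  have "below s (y - 1) a" using assms(2) by (simp add: below_shift)
  then have "0 < low (y - 1)" using False \<phi>_pos by (simp add: low_def low_left_def)
  then show ?thesis using low_shift[OF nb assms(2)] by simp
  qed
qed

lemma low_mono_below_a:
  assumes "y \<le> z" "below s z a"
  shows "low y \<le> low z"
proof -
  have ya: "below s y a" using assms below_mono by blast
  show ?thesis
  proof (cases "below s y (- 1 / b)")
    case False
    then have "\<not> below s z (- 1 / b)" using assms below_mono by blast
    then show ?thesis using False ya assms \<phi>_mono by (simp add: low_def low_left_def)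
  next
    case Y: True
    show ?thesis
    proof (cases "below s z (- 1 / b)")
      case False
      then show ?thesis
        using low_below_Sb_bounds(2)[OF Y] \<phi>_pos[of z] assms by (simp add: low_def low_left_def)
    next
      case Z: True
      have neg: "y < 0" "z < 0" using below_Sb_neg Y Z by auto
      show ?thesis
      proof (cases "below s (- 1 / z - 1) a")
        case False
        then have "low z = 0" using Z assms by (simp add: low_def low_left_def)
        then show ?thesis using low_below_Sb_bounds(2)[OF Y] by simp
      next
        case True
        have le: "- 1 / y - 1 \<le> - 1 / z - 1"
          using neg assms(1) le_imp_inverse_le_neg[of y z] by (simp add: inverse_eq_divide)
        then have "ext_\<phi> (- 1 / y - 1) \<le> ext_\<phi> (- 1 / z - 1)" using True ext_\<phi>_mono by blast
        moreover have "below s (- 1 / y - 1) a" using True le below_mono by blast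
        ultimately show ?thesis
          using True Y Z ya assms ext_\<phi>_nonneg[of "- 1 / y - 1"]
          by (simp add: low_def low_left_def frac_le)
      qed
    qed
  qed
qed

lemma low_mono:
  assumes "y \<le> z" "below s z (a + 1)"
  shows "low y \<le> low z"
proof (cases "below s z a")
  case True
  then show ?thesis using low_mono_below_a assms by blast
next
  case Z: False
  have za: "below s (z - 1) a" using assms by (simp add: below_shift)
  have z: "low z = 1 + low (z - 1)"
    using Z assms low_shift below_Sb_a by blast
  show ?thesis
  proof (cases "below s y (- 1 / b)")
    case True
    then show ?thesis using low_below_Sb_bounds(2)[OF True] low_ge_minus1[OF za] z by linarith
  next
    case False
    then have "low y = 1 + low (y - 1)" using assms low_shift below_mono by blast
    moreover have "low (y - 1) \<le> low (z - 1)" using assms(1) za by (intro low_mono_below_a) auto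
    ultimately show ?thesis using z by linarith
  qed
qed

lemma low_greater_below_a:
  assumes "below s y a"
  shows "y < low y"
proof (cases "below s y (- 1 / b)")
  case False
  then show ?thesis using assms \<phi>_pos[of y] below_a_neg[of y] by (simp add: low_def low_left_def)
next
  case True
  have y0: "y < 0" using below_Sb_neg True by blast
  show ?thesis
  proof (cases "y < - 1")
    case False
    then have "0 \<le> - 1 / y - 1" using y0 by (simp add: field_simps)
    then have "\<not> below s (- 1 / y - 1) a" using a_neg not_below_greater by auto
    then show ?thesis using True assms y0 by (simp add: low_def low_left_def)
  qed (use low_below_Sb_bounds(1)[OF True] in linarith)
qed

text \<open>
  This keeps the lower region off the diagonal.
\<close>

lemma low_greater:
  assumes "below s y (a + 1)"
  shows "y < low y"
proof (cases "below s y a")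
  case False
  then have "low y = 1 + low (y - 1)" using assms low_shift below_Sb_a by blast
  moreover have "y - 1 < low (y - 1)"
    using assms low_greater_below_a by (simp add: below_shift)
  ultimately show ?thesis by simp
qed (rule low_greater_below_a)

lemma finite_range_low: "finite (low ` {y. below s y (a + 1)})"
proof -
  let ?V = "insert 0 (\<phi> ` core)"
  let ?W = "?V \<union> (\<lambda>t. - 1 / (1 + t)) ` ?V"
  have "finite ?W" using \<phi>_finite by (simp add: core_def)
  moreover have low_left: "low_left y \<in> ?W" if "below s y a" for y
    using that by (auto simp: low_left_def ext_\<phi>_def core_def)
  have "low ` {y. below s y (a + 1)} \<subseteq> ?W \<union> (+) 1 ` ?W"
  proof
    fix x assume "x \<in> low ` {y. below s y (a + 1)}"
    then obtain y where y: "x = low y" "below s y (a + 1)" by blast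
    show "x \<in> ?W \<union> (+) 1 ` ?W"
    proof (cases "below s y a")
      case True
      then show ?thesis using low_left y by (simp only: low_def if_True UnI1)
    next
      case False
      then have "low_left (y - 1) \<in> ?W" using low_left y below_shift by blast
      then show ?thesis using y False by (simp only: low_def if_False) blast
    qed
  qed
  ultimately show ?thesis by (meson finite_UnI finite_imageI finite_subset)
qed

section \<open>Reflection and the fitting of the two boundaries\<close>

text \<open>
  The reflected upper boundary is \<open>-up (-p)\<close>; by the relation \<open>up (S p) = S (low p)\<close> it equals
  \<open>1 / \<phi> (1 / p)\<close> on the fundamental interval of the reflected parameters.
\<close>

definition dual_\<phi> :: "real \<Rightarrow> real" where "dual_\<phi> p = 1 / \<phi> (1 / p)"

lemma dual_below:
  assumes "p < 0"
  shows "below (\<not> s) p (- 1 / - a) \<longleftrightarrow> \<not> below s (1 / p) a"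
    and "below (\<not> s) p (- b) \<longleftrightarrow> \<not> below s (1 / p) (- 1 / b)"
  using below_inverse_same[of "1 / p" a s] below_inverse_same[of "1 / p" "- 1 / b" s] assms a_neg b_pos
  by auto

text \<open>
  Inverting \<open>p\<close> exchanges the two moves, \<open>1 / (p - 1) = r / (1 - r)\<close> for \<open>r = 1 / p\<close>, and inverting the values
  exchanges the two corresponding cases of the recursion.
\<close>

lemma dual: "boundary_data (- b) (- a) (\<not> s) dual_\<phi>"
proof
  have neg: "p < 0" if "below (\<not> s) p (- b)" for p
    using that b_pos below_imp_le by fastforce
  show "- b < 0" "0 < - a" "1 \<le> - a - - b" "- (- b * - a) \<le> 1"
    using a_neg b_pos ab_diff ab_prod by (auto simp: mult.commute)
  show "0 < dual_\<phi> p" if "\<not> below (\<not> s) p (- 1 / - a)" "below (\<not> s) p (- b)" for p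
    using that \<phi>_pos[of "1 / p"] dual_below[of p] neg[of p] by (simp add: dual_\<phi>_def)
  show "dual_\<phi> p \<le> dual_\<phi> q"
    if "\<not> below (\<not> s) p (- 1 / - a)" "below (\<not> s) q (- b)" "p \<le> q" for p q
  proof -
    have q: "q < 0" using that neg by blast
    then have p: "p < 0" using that by simp
    have le: "1 / q \<le> 1 / p" using p q that le_imp_inverse_le_neg[of p q] by (simp add: inverse_eq_divide)
    have 1: "\<not> below s (1 / q) (- 1 / b)" "below s (1 / p) a" using that dual_below p q by auto
    then have "0 < \<phi> (1 / q)" using \<phi>_pos[of "1 / q"] below_mono[of s "1 / p" a "1 / q" a] le by blast
    moreover have "\<phi> (1 / q) \<le> \<phi> (1 / p)" using \<phi>_mono 1 le by blast
    ultimately show ?thesis by (simp add: dual_\<phi>_def frac_le)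
  qed
  have "dual_\<phi> ` {p. \<not> below (\<not> s) p (- 1 / - a) \<and> below (\<not> s) p (- b)}
          \<subseteq> (\<lambda>t. 1 / t) ` \<phi> ` {p. \<not> below s p (- 1 / b) \<and> below s p a}"
    using neg dual_below unfolding dual_\<phi>_def by blast
  then show "finite (dual_\<phi> ` {p. \<not> below (\<not> s) p (- 1 / - a) \<and> below (\<not> s) p (- b)})"
    using \<phi>_finite by (meson finite_imageI finite_subset)
  have farey_inv: "1 / p / (1 - 1 / p) = 1 / (p - 1)" "1 / (p / (1 - p)) = 1 / p - 1" if "p < 0" for p :: real
    using that by (auto simp: field_simps)
  show "dual_\<phi> p = dual_\<phi> (p - 1) + 1"
    if "\<not> below (\<not> s) (p - 1) (- 1 / - a)" "below (\<not> s) p (- b)" for p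
  proof -
    have p: "p < 0" using that neg by blast
    have 1: "below s (1 / (p - 1)) a" "\<not> below s (1 / p) (- 1 / b)"
      using that p dual_below[of p] dual_below[of "p - 1"] by auto
    have "1 / p \<le> 1 / (p - 1)" using farey_ge[of "1 / p"] p farey_inv[OF p] by (simp add: field_simps)
    then have "below s (1 / p) a" using 1 below_mono by blast
    then show ?thesis using \<phi>_farey[of "1 / p"] 1 p farey_inv[OF p] by (simp add: dual_\<phi>_def)
  qed
  show "1 / dual_\<phi> p = 1 / dual_\<phi> (p / (1 - p)) + 1"
    if "\<not> below (\<not> s) p (- 1 / - a)" "below (\<not> s) (p / (1 - p)) (- b)" "below (\<not> s) p (- b)" for p
  proof -
    have p: "p < 0" "p / (1 - p) < 0" using that neg by blast+
    have "\<not> below s (1 / p - 1) (- 1 / b)" "below s (1 / p) a"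
      using that p dual_below[of p] dual_below(2)[of "p / (1 - p)"] farey_inv[OF p(1)] by auto
    then show ?thesis using \<phi>_shift[of "1 / p"] p farey_inv[OF p(1)] by (simp add: dual_\<phi>_def)
  qed
  show "dual_\<phi> p = 1"
    if "\<not> below (\<not> s) p (- 1 / - a)" "below (\<not> s) p (- b)"
      "below (\<not> s) (p - 1) (- 1 / - a)" "\<not> below (\<not> s) (p / (1 - p)) (- b)" for p
  proof -
    have p: "p < 0" using that neg by blast
    then have "p / (1 - p) < 0" by (simp add: divide_simps)
    note p = p this
    have "\<not> below s (1 / (p - 1)) a" "below s (1 / p - 1) (- 1 / b)"
         "\<not> below s (1 / p) (- 1 / b)" "below s (1 / p) a"
      using that p dual_below[of p] dual_below(2)[of "p / (1 - p)"] dual_below(1)[of "p - 1"]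
        farey_inv[OF p(1)] by auto
    then show ?thesis using \<phi>_base[of "1 / p"] p farey_inv[OF p(1)] by (simp add: dual_\<phi>_def)
  qed
qed

interpretation dual: boundary_data "- b" "- a" "\<not> s" dual_\<phi>
  by (rule dual)

definition up :: "real \<Rightarrow> real" where "up y = - dual.low (- y)"

lemma dual_dual_\<phi>: "dual.dual_\<phi> = \<phi>"
  by (auto simp: dual.dual_\<phi>_def dual_\<phi>_def)

text \<open>
  For \<open>w > 0\<close> the level \<open>S w - 1\<close> of the lower region takes its boundary from \<open>\<phi>\<close> at \<open>-1 / (1 + w)\<close>, and
  the level \<open>w\<close> of the upper region takes it from the dual function at the inverse of this point. This common
  source is why the two boundaries fit together. The formula also covers \<open>w = 0\<close>, which is needed at the level \<open>\<infinity>\<close>.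
\<close>

lemma up_via_\<phi>:
  assumes "0 \<le> w" "below s w b"
  shows "(if below s w (b - 1) then 0 else - 1 / up w) =
         (if below s (- 1 / (1 + w)) a then 1 - 1 / (1 + ext_\<phi> (- 1 / (1 + w))) else 1)"
proof -
  let ?v = "- 1 / (1 + w)"
  have inv: "1 / (- w - 1) = ?v" using assms(1) by (simp add: field_simps)
  have flip: "below (\<not> s) (- w) c \<longleftrightarrow> \<not> below s w (- c)" for c
    using below_uminus[of s w "- c"] by simp
  have vS: "below s ?v (- 1 / b) \<longleftrightarrow> below s w (b - 1)"
  proof -
    have "- 1 / ?v = w + 1" "?v < 0" using assms(1) by auto
    then show ?thesis
      using below_inverse_neg[of ?v b s] b_pos below_shift[of s "w + 1" "b - 1"] by simp
  qed
  have dual_core: "- w - 1 \<in> dual.core \<longleftrightarrow> ?v \<in> core"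
    using dual_below[of "- w - 1"] assms(1) inv by (auto simp: core_def dual.core_def)
  show ?thesis
  proof (cases "below s w (b - 1)")
    case True
    then have "below s ?v (- 1 / b)" using vS by blast
    then show ?thesis using True below_Sb_a by (auto simp: ext_\<phi>_def core_def)
  next
    case False
    have "\<not> below (\<not> s) (- w) (- b)" "below (\<not> s) (- w) (- b + 1)"
      using False assms(2) flip by auto
    then have low: "dual.low (- w) = 1 + dual.low (- w - 1)"
      using dual.low_shift dual.below_Sb_a by blast
    show ?thesis
    proof (cases "?v \<in> core")
      case True
      then have "dual.low (- w - 1) = 1 / \<phi> ?v"
        using dual_core inv by (simp add: dual.low_def dual.low_left_def dual.core_def dual_\<phi>_def)
      then have "dual.low (- w) = 1 + 1 / \<phi> ?v" using low by simp
      moreover have "- 1 / up w = 1 / dual.low (- w)" by (simp add: up_def)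
      ultimately have "- 1 / up w = 1 / (1 + 1 / \<phi> ?v)" by simp
      moreover have "0 < \<phi> ?v" using True \<phi>_pos by (simp add: core_def)
      then have "1 / (1 + 1 / \<phi> ?v) = 1 - 1 / (1 + \<phi> ?v)" by (simp add: divide_simps)
      ultimately show ?thesis
        using False True by (simp add: ext_\<phi>_def core_def)
    next
      case not_core: False
      then have "\<not> below s ?v a" using vS False by (simp add: core_def)
      moreover have "dual.low (- w - 1) = 0"
      proof (rule dual.low_pred_below_Sb)
        show "\<not> below (\<not> s) (- w) (- b)" "below (\<not> s) (- w) (- b + 1)" by fact+
        then show "below (\<not> s) (- w - 1) (- 1 / - a)"
          using not_core dual_core by (auto simp: dual.core_def below_shift)
      qed
      ultimately show ?thesis using low False by (simp add: up_def)
    qed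
  qed
qed

text \<open>
  The fitting condition over the level \<open>S w\<close>: the \<open>T\<close>-image of the arc over \<open>S w - 1\<close> begins where the
  \<open>S\<close>-image of the upper part over \<open>w\<close> ends. If \<open>w < b - 1\<close>, there is no upper part over \<open>w\<close>, and
  the end point is \<open>S \<infinity> = 0\<close>.
\<close>

lemma low_matches_up:
  assumes "0 < w" "below s w b"
  shows "low (- 1 / w - 1) + 1 = (if below s w (b - 1) then 0 else - 1 / up w)"
proof -
  let ?y = "- 1 / w - 1"
  have "below s (- 1 / w) (- 1 / b)"
    using below_inverse_neg[of "- 1 / w" b s] assms b_pos by simp
  then have y: "below s ?y (- 1 / b)" by (rule below_mono) auto
  have v: "- 1 / ?y - 1 = - 1 / (1 + w)" using assms(1) by (simp add: divide_simps)
  show ?thesis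
    unfolding up_via_\<phi>[OF less_imp_le[OF assms(1)] assms(2)] low_def low_left_def v
    using y below_Sb_a[OF y] by simp
qed

text \<open>
  The same condition over the level \<open>\<infinity> = S 0\<close>. There \<open>T\<^sup>-\<^sup>1\<close> maps the arc over \<open>\<infinity>\<close> to its
  left part, and \<open>S\<close> maps the arc over 0 to its right part.
\<close>

lemma low_matches_up_at_0:
  "(if below s 0 (b - 1) then 0 else - 1 / up 0) - 1 = (if below s 0 (a + 1) then - 1 / low 0 else 0)"
proof -
  have "below s 0 b" using b_pos below_less by blast
  then have *: "(if below s 0 (b - 1) then 0 else - 1 / up 0)
               = (if below s (- 1) a then 1 - 1 / (1 + ext_\<phi> (- 1)) else 1)"
    using up_via_\<phi>[of 0] by simp
  have sh: "below s 0 (a + 1) \<longleftrightarrow> below s (- 1) a" using below_shift[of s 0 a] by simp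
  show ?thesis
  proof (cases "below s (- 1) a")
    case True
    have "\<not> below s 0 (- 1 / b)" using b_pos by (intro not_below_greater) simp
    then have 1: "low 0 = 1 + low (- 1)" using low_shift[of 0] True sh by simp
    have "\<not> below s 0 a" using a_neg not_below_greater by blast
    then have "low (- 1) = ext_\<phi> (- 1)" using True by (auto simp: low_def low_left_def ext_\<phi>_def core_def)
    then show ?thesis unfolding * using 1 True sh by simp
  next
    case False
    then show ?thesis unfolding * using sh by simp
  qed
qed

section \<open>Images and preimages of the lower region\<close>

definition Low :: "(real \<times> real) set" where
  "Low = {(x, y). below s y (a + 1) \<and> low y \<le> x}"

definition Up :: "(real \<times> real) set" where
  "Up = {(x, y). \<not> below s y (b - 1) \<and> x \<le> up y}"

end

context boundary_data
begin

interpretation dual: boundary_data "- b" "- a" "\<not> s" dual_\<phi>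
  by (rule dual)

lemma dual_Low: "(- x, - y) \<in> dual.Low \<longleftrightarrow> (x, y) \<in> Up"
  using below_uminus[of s y "b - 1"] by (auto simp: dual.Low_def Up_def up_def)

lemma dual_up: "dual.up y = - low (- y)"
  by (simp add: dual.up_def dual_dual_\<phi>)

lemma dual_Up: "(- x, - y) \<in> dual.Up \<longleftrightarrow> (x, y) \<in> Low"
  using below_uminus[of s y "a + 1"] by (auto simp: dual.Up_def Low_def dual_up)

text \<open>
  In particular \<open>F\<close> never sends a point of the upper region over \<open>[a, b)\<close> to one with first
  coordinate \<open>\<infinity>\<close>.
\<close>

lemma up_neg:
  assumes "below s y b" "\<not> below s y (b - 1)"
  shows "up y \<le> - 1"
  using dual.low_ge_1[of "- y"] assms below_uminus[of s y b] below_uminus[of s y "b - 1"]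
  by (simp add: up_def)

text \<open>
  For \<open>y + 1 < S b\<close> the image of the arc is only a part of the arc over \<open>y + 1\<close>; the fitting condition
  shows that it begins to the right of 0, and \<open>low (y + 1) \<le> 0\<close>.
\<close>

lemma Low_shift:
  assumes "(x, y) \<in> Low" "below s y a"
  shows "(x + 1, y + 1) \<in> Low"
proof -
  have ya: "below s (y + 1) (a + 1)" using assms(2) below_shift[of s "y + 1" a] by simp
  have "low (y + 1) \<le> low y + 1"
  proof (cases "below s (y + 1) (- 1 / b)")
    case False
    then show ?thesis using low_shift[of "y + 1"] ya by simp
  next
    case True
    let ?w = "- 1 / (y + 1)"
    have y0: "y + 1 < 0" using below_Sb_neg True by blast
    then have w: "0 < ?w" "below s ?w b" using True below_inverse_neg[of "y + 1" b s] b_pos by (auto simp: divide_simps)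
    have "- 1 / ?w - 1 = y" using y0 by simp
    then have "low y + 1 = (if below s ?w (b - 1) then 0 else - 1 / up ?w)"
      using low_matches_up[OF w] by simp
    moreover have "0 \<le> - 1 / up ?w" if "\<not> below s ?w (b - 1)"
      using up_neg[OF w(2) that] by (simp add: divide_simps)
    ultimately show ?thesis
      using low_below_Sb_bounds(2)[OF True] by (smt (verit))
  qed
  then show ?thesis using assms ya by (auto simp: Low_def)
qed

lemma Low_S_pos:
  assumes "(x, y) \<in> Low" "0 < y" "below s y b"
  shows "(- 1 / x, - 1 / y) \<in> Low"
proof -
  have y: "below s y (a + 1)" "low y \<le> x" using assms(1) by (auto simp: Low_def)
  have yS: "below s (- 1 / y) (- 1 / b)"
    using below_inverse_neg[of "- 1 / y" b s] assms b_pos by simp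
  have "low (- 1 / y) = - 1 / low y" using low_below_Sb_cases[OF yS] y assms(2) by simp
  moreover have "0 < low y" using low_greater[of y] y assms(2) by linarith
  ultimately have "low (- 1 / y) \<le> - 1 / x" using y(2) by (simp add: frac_le)
  moreover have "below s (- 1 / y) (a + 1)"
    using below_Sb_a[OF yS] by (rule below_mono) auto
  ultimately show "(- 1 / x, - 1 / y) \<in> Low" by (simp add: Low_def)
qed

lemma Low_pos:
  assumes "(x, y) \<in> Low" "\<not> below s y a"
  shows "0 < x"
  using low_ge_1[of y] assms by (auto simp: Low_def)

lemma Low_S_neg:
  assumes "(x, y) \<in> Low" "y < 0" "\<not> below s y a"
  shows "(- 1 / x, - 1 / y) \<in> Up"
proof -
  have x: "0 < x" using Low_pos assms by blast
  have y1: "below (\<not> s) (1 / y) (- 1 / - a)" using below_inverse_same[of y a s] assms a_neg by simp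
  then have "dual.low (1 / y) \<le> 0" by (rule dual.low_below_Sb_bounds)
  then have "0 \<le> up (- 1 / y)" by (simp add: up_def)
  moreover have "- 1 / x < 0" using x by simp
  ultimately have "- 1 / x \<le> up (- 1 / y)" by linarith
  moreover have "\<not> below s (- 1 / y) (b - 1)"
    using dual.below_Sb_a[OF y1] below_uminus[of s "- 1 / y" b] below_mono[of s _ "b - 1" _ b]
    by auto
  ultimately show ?thesis by (simp add: Up_def)
qed

text \<open>
  A point of the lower region to the left of the \<open>T\<close>-image of the arc over \<open>y - 1\<close> is in the \<open>S\<close>-image
  of the arc over \<open>S y\<close>: in the image of the lower part if \<open>x < 0\<close>, of the upper part if \<open>x > 0\<close>. The point
  with \<open>x = 0\<close> is the image of a point at infinity.
\<close>

lemma Low_surj: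
  assumes "(x, y) \<in> Low"
  obtains (shift) "below s (y - 1) a" "(x - 1, y - 1) \<in> Low"
    | (inversion) "y < 0" "below s (- 1 / y) b" "\<not> below s (- 1 / y) a" "x \<noteq> 0" "(- 1 / x, - 1 / y) \<in> Low \<union> Up"
    | (zero) "y < 0" "below s (- 1 / y) b" "\<not> below s (- 1 / y) a" "x = 0" "\<not> below s (- 1 / y) (b - 1)"
proof -
  have y: "below s y (a + 1)" "low y \<le> x" using assms by (auto simp: Low_def)
  have ya: "below s (y - 1) a" using y(1) by (simp add: below_shift)
  have ya1: "below s (y - 1) (a + 1)" using y(1) by (rule below_mono) auto
  show ?thesis
  proof (cases "low (y - 1) + 1 \<le> x")
    case True
    then show ?thesis using ya ya1 shift by (simp add: Low_def)
  next
    case gap: False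
    have yS: "below s y (- 1 / b)"
      using low_shift[of y] y gap by (cases "below s y (- 1 / b)") auto
    have y0: "y < 0" using yS below_Sb_neg by blast
    let ?w = "- 1 / y"
    have w: "0 < ?w" "below s ?w b" using yS y0 below_inverse_neg[of y b s] b_pos by (auto simp: divide_simps)
    have wa: "\<not> below s ?w a" using w(1) a_neg by (intro not_below_greater) linarith
    have "- 1 / ?w - 1 = y - 1" using y0 by simp
    then have m: "x < (if below s ?w (b - 1) then 0 else - 1 / up ?w)"
      using low_matches_up[OF w] gap by simp
    have c: "low y = (if below s ?w (a + 1) then - 1 / low ?w else 0)"
      by (rule low_below_Sb_cases[OF yS])
    consider "x < 0" | "x = 0" | "0 < x" by linarith
    then show ?thesis
    proof cases
      case 1
      then have wa1: "below s ?w (a + 1)" using c y(2) by (auto split: if_splits)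
      then have "0 < low ?w" using low_greater[of ?w] w(1) by linarith
      then have "low ?w \<le> - 1 / x" using c wa1 y(2) 1 by (simp add: field_simps)
      then show ?thesis using inversion y0 w(2) wa wa1 1 by (simp add: Low_def)
    next
      case 2
      then show ?thesis using zero y0 w(2) wa m by (auto split: if_splits)
    next
      case 3
      then have wb1: "\<not> below s ?w (b - 1)" using m by auto
      then have "up ?w < 0" "x < - 1 / up ?w" using up_neg[OF w(2)] m by auto
      then have "- 1 / x \<le> up ?w" using 3 by (simp add: field_simps)
      then show ?thesis using inversion y0 w(2) wa wb1 3 by (simp add: Up_def)
    qed
  qed
qed

text \<open>
  The two image arcs over a common level meet in one point only, which is the image of the end point
  \<open>low (y - 1)\<close>.
\<close>

lemma Low_inj:
  assumes "below s (y - 1) a" "(x - 1, y - 1) \<in> Low"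
    and "y \<noteq> 0" "below s (- 1 / y) b" "\<not> below s (- 1 / y) a" "(- 1 / x, - 1 / y) \<in> Low \<union> Up"
  shows "x - 1 = low (y - 1)"
proof -
  let ?w = "- 1 / y"
  have y0: "y < 0"
  proof (rule ccontr)
    assume "\<not> y < 0"
    then have y: "0 < y" using assms(3) by simp
    have "a \<le> - 1 / y" using assms(5) not_below_imp_ge by blast
    then have "a * y \<le> - 1" using y by (simp add: field_simps)
    moreover have "y \<le> a + 1" using below_imp_le[OF assms(1)] by linarith
    then have "a * (a + 1) \<le> a * y" using a_neg by (intro mult_left_mono_neg) auto
    \<comment> \<open>a positive level has only one of the two preimages, since 1 + a + a^2 > 0\<close>
    moreover have "0 \<le> (a + 1 / 2) * (a + 1 / 2)" by simp
    ultimately show False by (simp add: algebra_simps)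
  qed
  have w: "0 < ?w" using y0 by (simp add: divide_simps)
  have "- 1 / ?w - 1 = y - 1" using y0 by simp
  then have m: "low (y - 1) + 1 = (if below s ?w (b - 1) then 0 else - 1 / up ?w)"
    using low_matches_up[OF w assms(4)] by simp
  have x: "low (y - 1) + 1 \<le> x" using assms(2) by (simp add: Low_def)
  have "0 \<le> low (y - 1) + 1" using low_ge_minus1[OF assms(1)] by simp
  then have x0: "0 \<le> x" using x by simp
  show ?thesis
  proof (cases "(- 1 / x, ?w) \<in> Low")
    case True
    then have "below s ?w (a + 1)" "low ?w \<le> - 1 / x" by (auto simp: Low_def)
    then have "0 < - 1 / x" using low_greater[of ?w] w by linarith
    then show ?thesis using x0 by (simp add: zero_less_divide_iff)
  next
    case False
    then have 1: "\<not> below s ?w (b - 1)" "- 1 / x \<le> up ?w" using assms(6) by (auto simp: Up_def)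
    then have 2: "up ?w \<le> - 1" using up_neg assms(4) by blast
    then have "0 < x" using 1 x0 by (cases "x = 0") auto
    then have "x \<le> - 1 / up ?w" using 1 2 by (simp add: field_simps)
    then show ?thesis using m 1 x by simp
  qed
qed

end

section \<open>Step functions and components\<close>

text \<open>
  Separated by disjoint open sets, two connected sets are the components of their union.
\<close>

lemma components_Un:
  fixes L U :: "'a::topological_space set"
  assumes "connected L" "connected U" "L \<noteq> {}" "U \<noteq> {}"
    and "open G" "open H" "G \<inter> H = {}" "L \<subseteq> G" "U \<subseteq> H"
  shows "components (L \<union> U) = {L, U}"
proof -
  have sep: "core \<subseteq> L \<or> core \<subseteq> U" if "connected core" "core \<subseteq> L \<union> U" for core
    using connectedD[OF that(1) assms(5,6)] that(2) assms(7-9) by blast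
  have L: "L \<in> components (L \<union> U)"
    unfolding in_components_maximal using sep assms by blast
  have U: "U \<in> components (L \<union> U)"
    unfolding in_components_maximal using sep assms by blast
  have "C = L \<or> C = U" if C: "C \<in> components (L \<union> U)" for C
  proof -
    obtain x where "x \<in> C" "x \<in> L \<union> U"
      using C in_components_nonempty in_components_subset by blast
    then show ?thesis using components_eq[OF C L] components_eq[OF C U] by blast
  qed
  then show ?thesis using L U by blast
qed

text \<open>
  All rays run into the product of a half-line with \<open>Y\<close>, which is convex.
\<close>

lemma connected_right_rays:
  fixes g :: "real \<Rightarrow> real"
  assumes "bdd_above (g ` Y)" "convex Y"
  shows "connected {(x, y). y \<in> Y \<and> g y \<le> x}"
proof (cases "Y = {}")
  case False
  let ?C = "{(x, y). y \<in> Y \<and> g y \<le> x}"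
  obtain M where M: "\<And>y. y \<in> Y \<Longrightarrow> g y \<le> M" using assms(1) by (auto simp: bdd_above_def)
  obtain y0 where y0: "y0 \<in> Y" using False by blast
  have sub: "{M..} \<times> Y \<subseteq> ?C" using M by force
  have conn: "connected ({M..} \<times> Y)" by (intro convex_connected convex_Times assms convex_real_interval)
  have ray: "connected ({g y..} \<times> {y})" for y
    by (intro convex_connected convex_Times convex_real_interval convex_singleton)
  have "connected (\<Union>y\<in>Y. {M..} \<times> Y \<union> {g y..} \<times> {y})"
  proof (rule connected_Union)
    show "connected s" if "s \<in> (\<lambda>y. {M..} \<times> Y \<union> {g y..} \<times> {y}) ` Y" for s
    proof -
      obtain y where y: "y \<in> Y" "s = {M..} \<times> Y \<union> {g y..} \<times> {y}" using \<open>s \<in> _\<close> by blast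
      have "(M, y) \<in> {M..} \<times> Y \<inter> {g y..} \<times> {y}" using y M by auto
      then show ?thesis unfolding y(2) by (intro connected_Un conn ray) blast
    qed
    have "(M, y0) \<in> \<Inter> ((\<lambda>y. {M..} \<times> Y \<union> {g y..} \<times> {y}) ` Y)" using y0 by auto
    then show "\<Inter> ((\<lambda>y. {M..} \<times> Y \<union> {g y..} \<times> {y}) ` Y) \<noteq> {}" by blast
  qed
  also have "(\<Union>y\<in>Y. {M..} \<times> Y \<union> {g y..} \<times> {y}) = ?C" using sub by auto
  finally show ?thesis .
qed simp

text \<open>
  The graph of a step function of \<open>y\<close> is turned into that of a step function of \<open>x\<close>: the new height
  over \<open>x\<close> is the supremum of the levels whose ray contains \<open>x\<close>. It depends on the values of \<open>g\<close>
  that do not exceed \<open>x\<close>, and there are only finitely many sets of such values.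
\<close>

lemma finite_rectangular_below:
  fixes g :: "real \<Rightarrow> real"
  assumes down: "\<And>y z. y \<le> z \<Longrightarrow> z \<in> Y \<Longrightarrow> y \<in> Y" and mono: "\<And>y z. y \<le> z \<Longrightarrow> z \<in> Y \<Longrightarrow> g y \<le> g z"
    and fin: "finite (g ` Y)"
  shows "finite_rectangular {(x, y). y \<in> Y \<and> g y \<le> x}"
proof -
  define h where "h x = Sup (ereal ` {y \<in> Y. g y \<le> x})" for x
  have "mono h" unfolding h_def by (intro monoI Sup_subset_mono image_mono) auto
  moreover have "finite (range h)"
  proof -
    have "range h \<subseteq> (\<lambda>V. Sup (ereal ` {y \<in> Y. g y \<in> V})) ` Pow (g ` Y)"
    proof
      fix t assume "t \<in> range h"
      then obtain x where "t = h x" by blast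
      moreover have "{y \<in> Y. g y \<le> x} = {y \<in> Y. g y \<in> {v \<in> g ` Y. v \<le> x}}" by auto
      ultimately show "t \<in> (\<lambda>V. Sup (ereal ` {y \<in> Y. g y \<in> V})) ` Pow (g ` Y)"
        unfolding h_def by (intro image_eqI[of _ _ "{v \<in> g ` Y. v \<le> x}"]) auto
    qed
    then show ?thesis using fin by (rule_tac finite_subset) auto
  qed
  ultimately have "step_function h" by (simp add: step_function_def)
  moreover have "{(x, y). ereal y < h x} \<subseteq> {(x, y). y \<in> Y \<and> g y \<le> x}"
  proof clarify
    fix x y assume "ereal y < h x"
    then obtain z where "z \<in> Y" "g z \<le> x" "y < z" unfolding h_def less_Sup_iff by auto
    then show "y \<in> Y \<and> g y \<le> x" using down[of y z] mono[of y z] by auto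
  qed
  moreover have "{(x, y). y \<in> Y \<and> g y \<le> x} \<subseteq> {(x, y). ereal y \<le> h x}"
    unfolding h_def by (auto intro: Sup_upper)
  ultimately show ?thesis unfolding finite_rectangular_def by blast
qed

lemma finite_rectangular_uminus:
  assumes "finite_rectangular C"
  shows "finite_rectangular {(x, y). (- x, - y) \<in> C}"
proof -
  obtain h where h: "step_function h"
    and C: "{(x, y). h x < ereal y} \<subseteq> C \<and> C \<subseteq> {(x, y). h x \<le> ereal y} \<or>
            {(x, y). ereal y < h x} \<subseteq> C \<and> C \<subseteq> {(x, y). ereal y \<le> h x}"
    using assms by (auto simp: finite_rectangular_def)
  define k where "k x = - h (- x)" for x
  have "mono k" using h by (auto simp: k_def step_function_def mono_def)
  moreover have "range k \<subseteq> uminus ` range h" by (auto simp: k_def)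
  ultimately have k: "step_function k"
    using h unfolding step_function_def by (meson finite_imageI finite_subset)
  have flip: "h (- x) < ereal (- y) \<longleftrightarrow> ereal y < k x" "ereal (- y) < h (- x) \<longleftrightarrow> k x < ereal y"
    "h (- x) \<le> ereal (- y) \<longleftrightarrow> ereal y \<le> k x" "ereal (- y) \<le> h (- x) \<longleftrightarrow> k x \<le> ereal y" for x y
    unfolding k_def by (metis ereal_minus_less_minus ereal_minus_le_minus ereal_uminus_uminus uminus_ereal.simps(1))+
  show ?thesis
    unfolding finite_rectangular_def
  proof (intro exI[of _ k] conjI k)
    show "{(x, y). k x < ereal y} \<subseteq> {(x, y). (- x, - y) \<in> C} \<and> {(x, y). (- x, - y) \<in> C} \<subseteq> {(x, y). k x \<le> ereal y} \<or>
      {(x, y). ereal y < k x} \<subseteq> {(x, y). (- x, - y) \<in> C} \<and> {(x, y). (- x, - y) \<in> C} \<subseteq> {(x, y). ereal y \<le> k x}"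
      using C by (elim disjE; unfold subset_iff; fastforce simp: flip[symmetric])
  qed
qed

section \<open>Slices of subsets of the torus\<close>

abbreviation circle :: "rbar topology" where
  "circle \<equiv> Alexandroff_compactification euclideanreal"

lemma topspace_circle: "topspace circle = UNIV"
  by (simp add: UNIV_option_conv)

lemma topspace_rbar_plane: "topspace rbar_plane = UNIV"
  unfolding rbar_plane_def topspace_prod_topology topspace_circle by simp

lemma subset_closure_rbar_plane: "S \<subseteq> rbar_plane closure_of S"
  by (rule closure_of_subset) (simp add: topspace_rbar_plane)

lemma continuous_map_slice:
  "continuous_map circle rbar_plane (\<lambda>x. (x, y))" "continuous_map circle rbar_plane (\<lambda>y. (x, y))"
  unfolding rbar_plane_def continuous_map_pairwise o_def by (simp_all add: topspace_circle del: topspace_Alexandroff_compactification)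

lemma slice_nhd_Some:
  assumes "openin rbar_plane V" "(Some x, y) \<in> V"
  shows "\<exists>e>0. \<forall>t. \<bar>t - x\<bar> < e \<longrightarrow> (Some t, y) \<in> V"
proof -
  have "continuous_map euclideanreal rbar_plane ((\<lambda>x. (x, y)) \<circ> Some)"
    by (rule continuous_map_compose[OF continuous_map_Some continuous_map_slice(1)])
  then have "openin euclideanreal {t \<in> topspace euclideanreal. ((\<lambda>x. (x, y)) \<circ> Some) t \<in> V}"
    using assms(1) by (rule openin_continuous_map_preimage)
  then have "open {t. (Some t, y) \<in> V}" by simp
  then show ?thesis using assms(2) unfolding open_dist dist_real_def by blast
qed

lemma circle_nhd_infinity:
  assumes "openin circle V" "None \<in> V"
  shows "\<exists>K. \<forall>t. K < \<bar>t\<bar> \<longrightarrow> Some t \<in> V"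
proof -
  obtain C where C: "compact C" "V = insert None (Some ` (- C))"
    using assms by (auto simp: openin_Alexandroff_compactification Compl_eq_Diff_UNIV)
  then obtain K where "\<And>t. t \<in> C \<Longrightarrow> norm t \<le> K"
    using compact_imp_bounded[OF C(1)] unfolding bounded_iff by blast
  then have "t \<notin> C" if "K < \<bar>t\<bar>" for t using that by force
  then show ?thesis using C(2) by auto
qed

lemma slice_nhd_infinity:
  assumes "openin rbar_plane V"
  shows "(None, y) \<in> V \<Longrightarrow> \<exists>K. \<forall>t. K < \<bar>t\<bar> \<longrightarrow> (Some t, y) \<in> V"
    and "(x, None) \<in> V \<Longrightarrow> \<exists>K. \<forall>t. K < \<bar>t\<bar> \<longrightarrow> (x, Some t) \<in> V"
proof -
  have 1: "openin circle {z. (z, y) \<in> V}" "openin circle {z. (x, z) \<in> V}"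
    using openin_continuous_map_preimage[OF continuous_map_slice(1) assms, of y]
      openin_continuous_map_preimage[OF continuous_map_slice(2) assms, of x]
    unfolding topspace_circle by simp_all
  show "\<exists>K. \<forall>t. K < \<bar>t\<bar> \<longrightarrow> (Some t, y) \<in> V" if "(None, y) \<in> V"
    using circle_nhd_infinity[OF 1(1)] that by simp
  show "\<exists>K. \<forall>t. K < \<bar>t\<bar> \<longrightarrow> (x, Some t) \<in> V" if "(x, None) \<in> V"
    using circle_nhd_infinity[OF 1(2)] that by simp
qed

text \<open>
  Boundary points of a set can be detected in horizontal slices, because slices are embedded
  continuously. This avoids any description of neighbourhoods in the torus.
\<close>

lemma frontier_endpoint:
  assumes "(Some x, y) \<in> A" and out: "\<And>e. e > 0 \<Longrightarrow> \<exists>t. \<bar>t - x\<bar> < e \<and> (Some t, y) \<notin> A"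
  shows "(Some x, y) \<in> rbar_plane frontier_of A"
proof -
  have "(Some x, y) \<in> rbar_plane closure_of A"
    using assms(1) subset_closure_rbar_plane by blast
  moreover have "(Some x, y) \<notin> rbar_plane interior_of A"
  proof
    assume "(Some x, y) \<in> rbar_plane interior_of A"
    from slice_nhd_Some[OF openin_interior_of this]
    obtain e where e: "e > 0" "\<forall>t. \<bar>t - x\<bar> < e \<longrightarrow> (Some t, y) \<in> rbar_plane interior_of A"
      by blast
    obtain t where "\<bar>t - x\<bar> < e" "(Some t, y) \<notin> A" using out[OF e(1)] by blast
    then show False using e(2) interior_of_subset[of rbar_plane A] by blast
  qed
  ultimately show ?thesis by (simp add: frontier_of_def)
qed

lemma frontier_infinity:
  assumes "(None, y) \<notin> A" and "\<And>K. \<exists>t. K < \<bar>t\<bar> \<and> (Some t, y) \<in> A"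
  shows "(None, y) \<in> rbar_plane frontier_of A"
proof -
  have "(None, y) \<in> rbar_plane closure_of A"
    unfolding in_closure_of topspace_rbar_plane
  proof (intro conjI allI impI UNIV_I)
    fix V assume V: "(None, y) \<in> V \<and> openin rbar_plane V"
    then obtain K where K: "\<forall>t. K < \<bar>t\<bar> \<longrightarrow> (Some t, y) \<in> V"
      using slice_nhd_infinity(1)[of V y] by blast
    obtain t where "K < \<bar>t\<bar>" "(Some t, y) \<in> A" using assms(2)[of K] by blast
    then show "\<exists>p. p \<in> A \<and> p \<in> V" using K by blast
  qed
  then show ?thesis
    using assms(1) interior_of_subset[of rbar_plane A] unfolding frontier_of_def by blast
qed

section \<open>The invariant set\<close>

lemma below_True: "below True = (<)" and below_False: "below False = (\<le>)"
  by (auto simp: below_def fun_eq_iff)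

locale attractor = boundary_data a b True \<phi> for a b :: real and \<phi> :: "real \<Rightarrow> real"
begin

interpretation dual: boundary_data "- b" "- a" False dual_\<phi>
  using dual by simp

lemma up_eq: "up y = - dual.low (- y)"
  using up_def by simp

lemma Up_iff: "(x, y) \<in> Up \<longleftrightarrow> (- x, - y) \<in> dual.Low"
  using dual_Low by simp

lemma Low_iff: "(x, y) \<in> Low \<longleftrightarrow> (- x, - y) \<in> dual.Up"
  using dual_Up by simp

lemma Low_simp: "(x, y) \<in> Low \<longleftrightarrow> y < a + 1 \<and> low y \<le> x"
  and Up_simp: "(x, y) \<in> Up \<longleftrightarrow> b - 1 \<le> y \<and> x \<le> up y"
  by (auto simp: Low_def Up_def below_True)

lemma Up_shift:
  assumes "(x, y) \<in> Up" "b \<le> y"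
  shows "(x - 1, y - 1) \<in> Up"
  using dual.Low_shift[of "- x" "- y"] assms by (simp add: Up_iff below_False)

lemma Up_neg:
  assumes "(x, y) \<in> Up" "y < b"
  shows "x < 0"
  using dual.Low_pos[of "- x" "- y"] assms by (simp add: Up_iff below_False)

lemma Up_S_neg:
  assumes "(x, y) \<in> Up" "y < 0" "a \<le> y"
  shows "(- 1 / x, - 1 / y) \<in> Up"
  using dual.Low_S_pos[of "- x" "- y"] assms by (simp add: Up_iff below_False)

lemma Up_S_pos:
  assumes "(x, y) \<in> Up" "0 < y" "y < b"
  shows "(- 1 / x, - 1 / y) \<in> Low"
  using dual.Low_S_neg[of "- x" "- y"] assms by (simp add: Up_iff Low_iff below_False)

lemma Up_surj:
  assumes "(x, y) \<in> Up"
  obtains (shift) "b \<le> y + 1" "(x + 1, y + 1) \<in> Up"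
    | (inversion) "0 < y" "a \<le> - 1 / y" "- 1 / y < b" "x \<noteq> 0" "(- 1 / x, - 1 / y) \<in> Low \<union> Up"
    | (zero) "0 < y" "a \<le> - 1 / y" "- 1 / y < b" "x = 0" "- 1 / y < a + 1"
proof (rule dual.Low_surj)
  show "(- x, - y) \<in> dual.Low" using assms by (simp add: Up_iff)
qed (use that in \<open>auto simp: Up_iff Low_iff below_False\<close>)

lemma Up_inj:
  assumes "b \<le> y + 1" "(x + 1, y + 1) \<in> Up"
    and "y \<noteq> 0" "a \<le> - 1 / y" "- 1 / y < b" "(- 1 / x, - 1 / y) \<in> Low \<union> Up"
  shows "x + 1 = up (y + 1)"
  using dual.Low_inj[of "- y" "- x"] assms by (auto simp: Up_iff Low_iff below_False up_eq)

lemma Low_greater: "(x, y) \<in> Low \<Longrightarrow> y < x"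
  using low_greater by (force simp: Low_simp below_True)

lemma Up_less: "(x, y) \<in> Up \<Longrightarrow> x < y"
  using dual.low_greater[of "- y"] by (force simp: Up_iff dual.Low_def)

text \<open>
  The right end point of the arc over the level \<open>\<infinity>\<close>, the image under \<open>S\<close> of \<open>up 0\<close>, or of \<open>\<infinity>\<close>
  if there is no upper part over 0.
\<close>

definition \<beta> :: real where
  "\<beta> = (if 0 < b - 1 then 0 else - 1 / up 0)"

lemma \<beta>_matching: "\<beta> - 1 = (if 0 < a + 1 then - 1 / low 0 else 0)"
  using low_matches_up_at_0 by (simp add: \<beta>_def below_True)

lemma low_0: "0 < a + 1 \<Longrightarrow> 1 \<le> low 0" and up_0: "b - 1 \<le> 0 \<Longrightarrow> up 0 \<le> - 1"
  using low_ge_1[of 0] up_neg[of 0] a_neg b_pos by (auto simp: below_True)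

lemma \<beta>_bounds: "0 \<le> \<beta>" "\<beta> \<le> 1"
proof -
  have "up 0 \<le> - 1 \<Longrightarrow> 0 \<le> - 1 / up 0" "1 \<le> low 0 \<Longrightarrow> - 1 / low 0 \<le> 0" by simp_all
  then show "0 \<le> \<beta>" "\<beta> \<le> 1"
    using up_0 low_0 \<beta>_matching unfolding \<beta>_def by (smt (verit))+
qed

text \<open>
  The level \<open>\<infinity>\<close> is needed because \<open>F\<close> maps the level 0 to it. Its arc is \<open>(-\<infinity>, \<beta>]\<close>.
\<close>

definition A :: "(rbar \<times> rbar) set" where
  "A = (\<lambda>(x, y). (Some x, Some y)) ` (Low \<union> Up) \<union> (\<lambda>x. (Some x, None)) ` {..\<beta>}"

lemma A_simps [simp]:
  "(Some x, Some y) \<in> A \<longleftrightarrow> (x, y) \<in> Low \<union> Up" "(Some x, None) \<in> A \<longleftrightarrow> x \<le> \<beta>" "(None, w) \<notin> A"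
  by (auto simp: A_def)

lemma finite_part_A: "finite_part A = Low \<union> Up"
  by (auto simp: finite_part_def)

lemma F_simps:
  "y < a \<Longrightarrow> F_ab a b (Some x, Some y) = (Some (x + 1), Some (y + 1))"
  "b \<le> y \<Longrightarrow> F_ab a b (Some x, Some y) = (Some (x - 1), Some (y - 1))"
  "a \<le> y \<Longrightarrow> y < b \<Longrightarrow> F_ab a b (x', Some y) = (mS x', mS (Some y))"
  "F_ab a b (Some x, None) = (Some (x - 1), None)"
  using a_neg b_pos by (auto simp: F_ab_def branch_def mT_def mTinv_def)

lemma mS_Some: "x \<noteq> 0 \<Longrightarrow> mS (Some x) = Some (- 1 / x)" "mS (Some 0) = None" "mS None = Some 0"
  by (auto simp: mS_def)

lemma A_cases:
  assumes "p \<in> A"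
  obtains (finite) x y where "p = (Some x, Some y)" "(x, y) \<in> Low \<union> Up"
    | (infinite) x where "p = (Some x, None)" "x \<le> \<beta>"
  using assms by (auto simp: A_def)

lemma y_ge_a: "(x, y) \<in> Up \<Longrightarrow> a \<le> y" and y_less_b: "(x, y) \<in> Low \<Longrightarrow> y < b"
  using ab_diff by (auto simp: Up_simp Low_simp)

text \<open>
  The case \<open>y = 0\<close> leads to the level \<open>\<infinity>\<close>; all others are covered by the lemmas on the two regions.
\<close>

lemma F_maps_into: "F_ab a b ` A \<subseteq> A"
proof (rule image_subsetI)
  fix p assume "p \<in> A"
  then show "F_ab a b p \<in> A"
  proof (cases rule: A_cases)
    case (infinite x)
    then show ?thesis by (simp add: F_simps)
  next
    case (finite x y)
    consider "y < a" | "b \<le> y" | "a \<le> y" "y < b" by linarith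
    then show ?thesis
    proof cases
      case 1
      then have "(x + 1, y + 1) \<in> Low" using finite Low_shift y_ge_a by (force simp: below_True)
      then show ?thesis using finite 1 by (simp add: F_simps)
    next
      case 2
      then have "(x - 1, y - 1) \<in> Up" using finite Up_shift y_less_b by force
      then show ?thesis using finite 2 by (simp add: F_simps)
    next
      case 3
      have x0: "x \<noteq> 0" using finite(2) Up_neg[of x y] Low_pos[of x y] 3 by (auto simp: below_True)
      show ?thesis
      proof (cases "y = 0")
        case True
        have "- 1 / x \<le> \<beta>"
        proof (cases "(x, 0) \<in> Low")
          case True
          then have "0 < x" using Low_pos[of x 0] a_neg by (auto simp: below_True)
          then have "- 1 / x \<le> 0" by simp
          then show ?thesis using \<beta>_bounds by linarith
        next
          case False
          then have u: "b - 1 \<le> 0" "x \<le> up 0" using finite True by (auto simp: Up_simp)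
          then have "up 0 \<le> - 1" using up_0 by blast
          then have "- 1 / x \<le> - 1 / up 0" using u by (simp add: divide_simps)
          then show ?thesis using u by (simp add: \<beta>_def)
        qed
        then show ?thesis using finite 3 True x0 by (simp add: F_simps mS_Some)
      next
        case False
        have "(- 1 / x, - 1 / y) \<in> Low \<union> Up"
          using finite(2) False 3 Low_S_pos[of x y] Low_S_neg[of x y] Up_S_neg[of x y] Up_S_pos[of x y]
          by (cases "y < 0") (auto simp: below_True)
        then show ?thesis using finite 3 False x0 by (simp add: F_simps mS_Some)
      qed
    qed
  qed
qed

lemma Low_infinity_frontier: "y < a + 1 \<Longrightarrow> (None, Some y) \<in> rbar_plane frontier_of A"
proof (rule frontier_infinity)
  assume y: "y < a + 1"
  fix K :: real
  have "(Some (max (low y) (\<bar>K\<bar> + 1)), Some y) \<in> A" using y by (simp add: Low_simp)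
  moreover have "K < \<bar>max (low y) (\<bar>K\<bar> + 1)\<bar>" by linarith
  ultimately show "\<exists>t. K < \<bar>t\<bar> \<and> (Some t, Some y) \<in> A" by blast
qed simp

lemma Up_infinity_frontier: "b - 1 \<le> y \<Longrightarrow> (None, Some y) \<in> rbar_plane frontier_of A"
proof (rule frontier_infinity)
  assume y: "b - 1 \<le> y"
  fix K :: real
  have "(Some (min (up y) (- \<bar>K\<bar> - 1)), Some y) \<in> A" using y by (simp add: Up_simp)
  moreover have "K < \<bar>min (up y) (- \<bar>K\<bar> - 1)\<bar>" by linarith
  ultimately show "\<exists>t. K < \<bar>t\<bar> \<and> (Some t, Some y) \<in> A" by blast
qed simp

text \<open>
  Just to the left of \<open>low y\<close> the slice has a gap, since \<open>up y < y < low y\<close>.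
\<close>

lemma low_frontier:
  assumes "y < a + 1"
  shows "(Some (low y), Some y) \<in> rbar_plane frontier_of A"
proof (rule frontier_endpoint)
  have y: "y < low y" using low_greater assms by (simp add: below_True)
  show "(Some (low y), Some y) \<in> A" using assms by (simp add: Low_simp)
  fix e :: real assume e: "e > 0"
  define t where "t = max y (low y - e / 2)"
  have t: "y \<le> t" "t < low y" "\<bar>t - low y\<bar> < e" using y e by (auto simp: t_def)
  have "(t, y) \<notin> Up" using Up_less t by force
  then show "\<exists>t. \<bar>t - low y\<bar> < e \<and> (Some t, Some y) \<notin> A"
    using t by (intro exI[of _ t]) (simp add: Low_simp)
qed

lemma up_frontier:
  assumes "b - 1 \<le> y"
  shows "(Some (up y), Some y) \<in> rbar_plane frontier_of A"
proof (rule frontier_endpoint)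
  show up: "(Some (up y), Some y) \<in> A" using assms by (simp add: Up_simp)
  have y: "up y < y" using assms Up_less[of "up y" y] by (simp add: Up_simp)
  fix e :: real assume e: "e > 0"
  define t where "t = min y (up y + e / 2)"
  have t: "t \<le> y" "up y < t" "\<bar>t - up y\<bar> < e" using y e by (auto simp: t_def)
  have "(t, y) \<notin> Low" using Low_greater t by force
  then show "\<exists>t. \<bar>t - up y\<bar> < e \<and> (Some t, Some y) \<notin> A"
    using t by (intro exI[of _ t]) (simp add: Up_simp)
qed

lemma \<beta>_frontier: "(Some \<beta>, None) \<in> rbar_plane frontier_of A"
proof (rule frontier_endpoint)
  fix e :: real assume "e > 0"
  then show "\<exists>t. \<bar>t - \<beta>\<bar> < e \<and> (Some t, None) \<notin> A" by (intro exI[of _ "\<beta> + e / 2"]) simp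
qed simp

text \<open>
  Points \<open>(0, S w)\<close> are the only ones that can fail to have a preimage, and they are images of the
  points \<open>(\<infinity>, w)\<close>, which are limits of points of \<open>A\<close> as soon as the slice over \<open>w\<close> is nonempty.
\<close>

lemma F_surjective:
  assumes "q \<in> A" "q \<notin> F_ab a b ` (rbar_plane frontier_of A)"
  shows "\<exists>p \<in> A. F_ab a b p = q"
proof -
  have zero_excluded: False if "q = (Some 0, y)" "a \<le> w" "w < b" "y = mS (Some w)" "w < a + 1 \<or> b - 1 \<le> w" for y w
  proof -
    have "F_ab a b (None, Some w) = q" using that by (simp add: F_simps mS_Some)
    then show False
      using assms(2) that(5) Low_infinity_frontier Up_infinity_frontier by (metis image_eqI)
  qed
  have S_preimage: ?thesis
    if "q = (Some x, y)" "x \<noteq> 0" "a \<le> w" "w < b" "y = mS (Some w)" "(- 1 / x, w) \<in> Low \<union> Up" for x y w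
  proof
    show "(Some (- 1 / x), Some w) \<in> A" using that by (simp only: A_simps)
    show "F_ab a b (Some (- 1 / x), Some w) = q" using that by (simp add: F_simps mS_Some)
  qed
  from assms(1) show ?thesis
  proof (cases rule: A_cases)
    case (finite x y)
    have S: "Some y = mS (Some (- 1 / y))" if "y \<noteq> 0" using that by (simp add: mS_Some)
    show ?thesis
    proof (cases "(x, y) \<in> Low")
      case True
      then show ?thesis
      proof (cases rule: Low_surj)
        case shift
        then show ?thesis
          using finite by (intro bexI[of _ "(Some (x - 1), Some (y - 1))"]) (auto simp: F_simps below_True)
      next
        case inversion
        then have "a \<le> - 1 / y" "- 1 / y < b" "y \<noteq> 0" by (auto simp: below_True)
        then show ?thesis using S_preimage finite(1) inversion S by blast
      next
        case zero
        then have "a \<le> - 1 / y" "- 1 / y < b" "y \<noteq> 0" "b - 1 \<le> - 1 / y" by (auto simp: below_True)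
        then show ?thesis using zero_excluded finite(1) zero S by blast
      qed
    next
      case False
      then have "(x, y) \<in> Up" using finite by simp
      then show ?thesis
      proof (cases rule: Up_surj)
        case shift
        then show ?thesis
          using finite by (intro bexI[of _ "(Some (x + 1), Some (y + 1))"]) (auto simp: F_simps)
      next
        case inversion
        then show ?thesis using S_preimage finite(1) S by blast
      next
        case zero
        then show ?thesis using zero_excluded finite(1) S by blast
      qed
    qed
  next
    case (infinite x)
    have S: "None = mS (Some 0)" by (simp add: mS_Some)
    show ?thesis
    proof (cases "x \<le> \<beta> - 1")
      case True
      then show ?thesis
        using infinite by (intro bexI[of _ "(Some (x + 1), None)"]) (auto simp: F_simps)
    next
      case False
      consider "x < 0" | "x = 0" | "0 < x" by linarith
      then show ?thesis
      proof cases
        case 1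
        then have l: "0 < a + 1" "- 1 / low 0 < x"
          using False \<beta>_matching by (auto split: if_splits)
        then have "low 0 \<le> - 1 / x" using low_0 1 by (simp add: field_simps)
        then have "(- 1 / x, 0) \<in> Low \<union> Up" using l by (simp add: Low_simp)
        then show ?thesis using S_preimage[OF infinite(1) _ _ _ S] 1 a_neg b_pos by simp
      next
        case 2
        then have "0 < a + 1" using False \<beta>_matching by (auto split: if_splits)
        then show ?thesis using zero_excluded[of None 0] infinite(1) 2 a_neg b_pos S by simp
      next
        case 3
        then have u: "b - 1 \<le> 0" "x \<le> - 1 / up 0"
          using infinite(2) by (auto simp: \<beta>_def split: if_splits)
        then have "- 1 / x \<le> up 0" using up_0 3 by (simp add: field_simps)
        then have "(- 1 / x, 0) \<in> Low \<union> Up" using u by (simp add: Up_simp)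
        then show ?thesis using S_preimage[OF infinite(1) _ _ _ S] 3 a_neg b_pos by simp
      qed
    qed
  qed
qed

section \<open>Points with two preimages\<close>

lemma preimage_cases:
  assumes "p \<in> A" "F_ab a b p = (Some x, Some y)"
  obtains (T) "p = (Some (x - 1), Some (y - 1))" "y - 1 < a" "(x - 1, y - 1) \<in> Low"
    | (Tinv) "p = (Some (x + 1), Some (y + 1))" "b \<le> y + 1" "(x + 1, y + 1) \<in> Up"
    | (S) "p = (Some (- 1 / x), Some (- 1 / y))" "y \<noteq> 0" "a \<le> - 1 / y" "- 1 / y < b"
        "(- 1 / x, - 1 / y) \<in> Low \<union> Up"
  using assms(1)
proof (cases rule: A_cases)
  case (infinite u)
  then show ?thesis using assms(2) by (simp add: F_simps)
next
  case (finite u v)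
  consider "v < a" | "b \<le> v" | "a \<le> v" "v < b" by linarith
  then show ?thesis
  proof cases
    case 1
    then show ?thesis using finite T assms(2) y_ge_a by (force simp: F_simps)
  next
    case 2
    then show ?thesis using finite Tinv assms(2) y_less_b by (force simp: F_simps)
  next
    case 3
    then have "mS (Some u) = Some x" "mS (Some v) = Some y" using assms(2) finite by (auto simp: F_simps)
    then have "u \<noteq> 0" "v \<noteq> 0" "x = - 1 / u" "y = - 1 / v" by (auto simp: mS_def split: if_splits)
    then have "u = - 1 / x" "v = - 1 / y" "y \<noteq> 0" by auto
    then show ?thesis using S finite 3 by blast
  qed
qed

lemma T_S_overlap_frontier:
  assumes "y - 1 < a" "(x - 1, y - 1) \<in> Low" "y \<noteq> 0" "a \<le> - 1 / y" "- 1 / y < b"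
    "(- 1 / x, - 1 / y) \<in> Low \<union> Up"
  shows "(Some (x - 1), Some (y - 1)) \<in> rbar_plane frontier_of A"
proof -
  have "x - 1 = low (y - 1)" using Low_inj[of y x] assms by (simp add: below_True)
  then show ?thesis using low_frontier[of "y - 1"] assms(1) by simp
qed

lemma Tinv_S_overlap_frontier:
  assumes "b \<le> y + 1" "(x + 1, y + 1) \<in> Up" "y \<noteq> 0" "a \<le> - 1 / y" "- 1 / y < b"
    "(- 1 / x, - 1 / y) \<in> Low \<union> Up"
  shows "(Some (x + 1), Some (y + 1)) \<in> rbar_plane frontier_of A"
proof -
  have "x + 1 = up (y + 1)" using Up_inj[of y x] assms by simp
  then show ?thesis using up_frontier[of "y + 1"] assms(1) by simp
qed

text \<open>
  Preimages under \<open>T\<close> and \<open>T\<^sup>-\<^sup>1\<close> cannot coexist: their images lie on different sides of the diagonal.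
  In the remaining cases the image arcs of two levels are adjacent, so one of the preimages is an end point.
\<close>

lemma F_injective:
  assumes "p \<in> A" "p' \<in> A" "F_ab a b p = F_ab a b p'"
  shows "p = p' \<or> p \<in> rbar_plane frontier_of A \<or> p' \<in> rbar_plane frontier_of A"
proof -
  have "F_ab a b p \<in> A" using F_maps_into assms(1) by blast
  then show ?thesis
  proof (cases rule: A_cases)
    case (finite x y)
    have fin': "F_ab a b p' = (Some x, Some y)" using finite assms(3) by simp
    have TT: False if "(x - 1, y - 1) \<in> Low" "(x + 1, y + 1) \<in> Up"
      using Low_greater[OF that(1)] Up_less[OF that(2)] by simp
    note overlap = T_S_overlap_frontier[of y x] Tinv_S_overlap_frontier[of y x]
    from assms(1) finite(1) show ?thesis
    proof (cases rule: preimage_cases)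
      case T
      from assms(2) fin' show ?thesis
        by (cases rule: preimage_cases) (use T TT overlap in auto)
    next
      case Tinv
      from assms(2) fin' show ?thesis
        by (cases rule: preimage_cases) (use Tinv TT overlap in auto)
    next
      case S
      from assms(2) fin' show ?thesis
        by (cases rule: preimage_cases) (use S TT overlap in auto)
    qed
  next
    case (infinite x)
    have pre: "r = (Some (x + 1), None) \<and> x + 1 \<le> \<beta> \<or>
               r = (Some (- 1 / x), Some 0) \<and> (- 1 / x, 0) \<in> Low \<union> Up"
      if "r \<in> A" "F_ab a b r = (Some x, None)" for r
      using that(1)
    proof (cases rule: A_cases)
      case (infinite u)
      then show ?thesis using that(2) by (auto simp: F_simps)
    next
      case (finite u v)
      have v: "a \<le> v" "v < b" using finite that(2) F_simps(1,2)[of v u] by force+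
      then have "mS (Some u) = Some x" "mS (Some v) = None" using that finite by (auto simp: F_simps)
      then have "u \<noteq> 0" "v = 0" "x = - 1 / u" by (auto simp: mS_def split: if_splits)
      then show ?thesis using finite by simp
    qed
    have "x + 1 = \<beta>" if "x + 1 \<le> \<beta>" "(- 1 / x, 0) \<in> Low \<union> Up"
    proof -
      have x: "x \<le> 0" "x \<le> \<beta> - 1" using that(1) \<beta>_bounds by auto
      have "(- 1 / x, 0) \<in> Low"
        using that(2) Up_neg[of "- 1 / x" 0] b_pos x(1) by (auto simp: divide_less_0_iff)
      then have l: "0 < a + 1" "low 0 \<le> - 1 / x" by (auto simp: Low_simp)
      then have "1 \<le> low 0" "x < 0" using low_0 x(1) by (cases "x = 0"; force)+
      then have "- 1 / low 0 \<le> x" using l(2) by (simp add: field_simps)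
      then show ?thesis using x(2) \<beta>_matching l(1) by simp
    qed
    then show ?thesis
      using pre[OF assms(1) infinite(1)] pre[OF assms(2)] infinite(1) assms(3) \<beta>_frontier by auto
  qed
qed

lemma bijection: "bijection_except_boundary (F_ab a b) A"
  unfolding bijection_except_boundary_def
proof (intro conjI ballI F_maps_into)
  fix q assume q: "q \<in> A - F_ab a b ` (rbar_plane frontier_of A)"
  then obtain p where p: "p \<in> A" "F_ab a b p = q" using F_surjective by blast
  show "\<exists>!p. p \<in> A \<and> F_ab a b p = q"
  proof (rule ex1I)
    show "p \<in> A \<and> F_ab a b p = q" using p by blast
    fix p' assume p': "p' \<in> A \<and> F_ab a b p' = q"
    then have "F_ab a b p = F_ab a b p'" using p by simp
    moreover have "r \<notin> rbar_plane frontier_of A" if "F_ab a b r = q" for r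
      using q that by blast
    then have "p \<notin> rbar_plane frontier_of A" "p' \<notin> rbar_plane frontier_of A"
      using p p' by blast+
    ultimately show "p' = p" using F_injective p p' by blast
  qed
qed

section \<open>The two components\<close>

lemma Low_alt: "Low = {(x, y). y \<in> {..<a + 1} \<and> low y \<le> x}"
  by (auto simp: Low_simp)

lemma dual_Low_alt: "dual.Low = {(x, y). y \<in> {..- b + 1} \<and> dual.low y \<le> x}"
  by (auto simp: dual.Low_def below_False)

lemma Up_alt: "Up = {(x, y). (- x, - y) \<in> dual.Low}"
  using Up_iff by auto

lemma components_finite_part: "components (finite_part A) = {Low, Up}"
  unfolding finite_part_A
proof (rule components_Un)
  have "finite (low ` {..<a + 1})" "finite (dual.low ` {..- b + 1})"
    using finite_range_low dual.finite_range_low by (simp_all add: below_True below_False lessThan_def atMost_def)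
  then have bdd: "bdd_above (low ` {..<a + 1})" "bdd_above (dual.low ` {..- b + 1})"
    by (simp_all only: bdd_above_finite)
  show "connected Low"
    unfolding Low_alt using bdd(1) by (rule connected_right_rays) (rule convex_real_interval)
  have "connected dual.Low"
    unfolding dual_Low_alt using bdd(2) by (rule connected_right_rays) (rule convex_real_interval)
  then have "connected (uminus ` dual.Low)"
    by (intro connected_continuous_image continuous_on_minus continuous_on_id)
  moreover have "uminus ` dual.Low = Up"
  proof (intro equalityI subsetI)
    fix p assume "p \<in> uminus ` dual.Low"
    then obtain u v where "p = (- u, - v)" "(u, v) \<in> dual.Low" by auto
    then show "p \<in> Up" using Up_iff[of "- u" "- v"] by simp
  next
    fix p assume p: "p \<in> Up"
    obtain x y where xy: "p = (x, y)" by fastforce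
    then have "p = - (- x, - y)" by simp
    moreover have "(- x, - y) \<in> dual.Low" using p xy Up_iff by blast
    ultimately show "p \<in> uminus ` dual.Low" by (rule image_eqI)
  qed
  ultimately show "connected Up" by simp
  have "(low a, a) \<in> Low" "(up b, b) \<in> Up" by (auto simp: Low_simp Up_simp)
  then show "Low \<noteq> {}" "Up \<noteq> {}" by blast+
  show "open {p :: real \<times> real. snd p < fst p}" "open {p :: real \<times> real. fst p < snd p}"
    by (intro open_Collect_less continuous_on_fst continuous_on_snd continuous_on_id)+
  show "{p :: real \<times> real. snd p < fst p} \<inter> {p. fst p < snd p} = {}" by auto
  show "Low \<subseteq> {p. snd p < fst p}" "Up \<subseteq> {p. fst p < snd p}"
    by (auto dest: Low_greater Up_less)
qed

lemma Low_neq_Up: "Low \<noteq> Up"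
proof -
  have a: "(low a, a) \<in> Low" by (simp add: Low_simp)
  then have "(low a, a) \<notin> Up" using Low_greater[of "low a" a] Up_less[of "low a" a] by linarith
  then show ?thesis using a by metis
qed

lemma finite_rectangular_Low_Up: "finite_rectangular Low" "finite_rectangular Up"
proof -
  show "finite_rectangular Low"
    unfolding Low_alt using finite_range_low low_mono
    by (intro finite_rectangular_below) (auto simp: below_True lessThan_def)
  have "finite_rectangular dual.Low"
    unfolding dual_Low_alt using dual.finite_range_low dual.low_mono
    by (intro finite_rectangular_below) (auto simp: below_False atMost_def)
  then show "finite_rectangular Up" unfolding Up_alt by (rule finite_rectangular_uminus)
qed

text \<open>
  A point \<open>(x, \<infinity>)\<close> is the limit of points \<open>(x, t)\<close> of the upper region with \<open>t \<rightarrow> \<infinity>\<close> if \<open>x \<le> 0\<close>, since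
  \<open>up t \<ge> 0\<close> there, and of points of the lower region with \<open>t \<rightarrow> -\<infinity>\<close> if \<open>x > 0\<close>.
\<close>

lemma A_subset_closure:
  "A \<subseteq> rbar_plane closure_of ((\<lambda>(x, y). (Some x, Some y)) ` finite_part A)"
proof
  let ?E = "(\<lambda>(x, y). (Some x, Some y)) ` finite_part A"
  fix p assume p: "p \<in> A"
  then show "p \<in> rbar_plane closure_of ?E"
  proof (cases rule: A_cases)
    case (finite x y)
    then have "p \<in> ?E" by (auto simp: finite_part_A)
    then show ?thesis using subset_closure_rbar_plane by blast
  next
    case (infinite x)
    have "\<exists>y\<in>?E. y \<in> V" if V: "p \<in> V" "openin rbar_plane V" for V
    proof -
      obtain K where K: "\<And>t. K < \<bar>t\<bar> \<Longrightarrow> (Some x, Some t) \<in> V"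
        using slice_nhd_infinity(2)[OF V(2)] V(1) infinite(1) by blast
      show ?thesis
      proof (cases "x \<le> 0")
        case True
        define t where "t = max (b + (- 1 / a)) (\<bar>K\<bar> + 1)"
        have "0 < - 1 / a" using a_neg by (simp add: divide_simps)
        then have t: "b \<le> t" "- 1 / a \<le> t" "K < \<bar>t\<bar>" using b_pos unfolding t_def by linarith+
        then have "below False (- t) (- 1 / - a)" by (simp add: below_False)
        then have "dual.low (- t) \<le> 0" by (rule dual.low_below_Sb_bounds)
        then have "(x, t) \<in> Up" using t True by (simp add: Up_simp up_eq)
        then show ?thesis using K[OF t(3)] by (force simp: finite_part_A)
      next
        case False
        define t where "t = min (a - 1 / b - 1) (- \<bar>K\<bar> - 1)"
        have "0 < 1 / b" using b_pos by simp
        then have t: "t \<le> a" "t < - 1 / b" "K < \<bar>t\<bar>" using a_neg unfolding t_def by linarith+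
        then have "below True t (- 1 / b)" by (simp add: below_True)
        then have "low t \<le> 0" by (rule low_below_Sb_bounds)
        then have "(x, t) \<in> Low" using t False by (simp add: Low_simp)
        then show ?thesis using K[OF t(3)] by (force simp: finite_part_A)
      qed
    qed
    then show ?thesis unfolding in_closure_of topspace_rbar_plane by blast
  qed
qed

lemma two_components: "two_rectangular_components A"
  unfolding two_rectangular_components_def components_finite_part
  using Low_neq_Up finite_rectangular_Low_Up A_subset_closure by auto

lemma A_off_diagonal: "A \<inter> diagonal = {}"
  using Low_greater Up_less by (fastforce simp: A_def diagonal_def)

end

section \<open>Proof of the theorem\<close>

text \<open>
  The fixed point of the Farey recursion yields boundary data exactly because its two moves exclude
  each other.
\<close>

lemma (in parameters) attractor_phi:
  assumes "finiteness_condition a b"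
  shows "attractor a b phi"
proof
  show "0 < phi p" if "\<not> below True p (- 1 / b)" "below True p a" for p
    using that phi_pos by (simp add: below_True)
  show "phi p \<le> phi q" if "\<not> below True p (- 1 / b)" "below True q a" "p \<le> q" for p q
    using that phi_mono by (simp add: below_True)
  have "{p. \<not> below True p (- 1 / b) \<and> below True p a} = {- 1 / b..<a}" by (auto simp: below_True)
  then show "finite (phi ` {p. \<not> below True p (- 1 / b) \<and> below True p a})"
    using finite_phi[OF assms] by simp
  show "phi p = phi (p - 1) + 1" if "\<not> below True (p - 1) (- 1 / b)" "below True p a" for p
    using that phi_fixed[of p] by (simp add: below_True boundary_step_def)
  show "1 / phi p = 1 / phi (p / (1 - p)) + 1"
    if "\<not> below True p (- 1 / b)" "below True (p / (1 - p)) a" "below True p a" for p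
  proof -
    let ?r = "p / (1 - p)"
    have p: "- 1 / b \<le> p" "?r < a" "p < a" using that by (auto simp: below_True)
    then have "\<not> - 1 / b \<le> p - 1" using shift_excludes_farey[of p] by linarith
    then have "phi p = phi ?r / (1 + phi ?r)" using phi_fixed[of p] p by (simp add: boundary_step_def)
    moreover have "0 < phi ?r" using phi_pos[of ?r] p farey_ge[of p] a_neg by linarith
    ultimately show ?thesis by (simp add: add_divide_distrib)
  qed
  show "phi p = 1"
    if "\<not> below True p (- 1 / b)" "below True p a" "below True (p - 1) (- 1 / b)"
      "\<not> below True (p / (1 - p)) a" for p
    using that phi_fixed[of p] by (simp add: below_True boundary_step_def)
qed

theorem theorem5p5:
  fixes a b :: real
  assumes "(a, b) \<in> parameter_set"
    and "a \<noteq> 0"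
    and "b \<noteq> 0"
    and "finiteness_condition a b"
  shows "\<exists>A :: (rbar \<times> rbar) set.
           A \<subset> UNIV \<and> A \<inter> diagonal = {} \<and>
           two_rectangular_components A \<and>
           bijection_except_boundary (F_ab a b) A"
proof -
  interpret parameters a b
    using assms by unfold_locales (auto simp: parameter_set_def)
  interpret attractor a b phi
    using assms(4) by (rule attractor_phi)
  have "A \<noteq> UNIV" using A_simps(3)[of None] by blast
  then show ?thesis using A_off_diagonal two_components bijection by blast
qed

end
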